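(* Let $\tau$ be a periodic billiard trajectory on the regular pentagon having order $5$ rotational symmetry. Then the length of its periodic billiard sequence (the number of bounces in one period) is five times the length of the corresponding cutting word for the double pentagon, except for the horizontal trajectories (the mini pentagon and the star), for which it is half of this.
   Context: Let $Q$ be a regular pentagon centered at the origin with a horizontal side; it is the billiard table. The double pentagon is the translation surface obtained from $Q$ and $-Q$ by gluing each side of $Q$ by translation to the parallel side of $-Q$. The necklace is the translation surface which is the unfolding of the billiard table $Q$: letting $D$ be the dihedral group of order 10 generated by the linear reflections $s_e$ in the directions of the sides $e$ of $Q$, it is made of the ten pentagons $gQ$, $g\in D$ (each equal to $Q$ or $-Q$), with side $ge$ of the copy $gQ$ glued by translation to the parallel side of the copy $gs_eQ$. It is a 5-fold cover of the double pentagon, and folding ($gx\mapsto x$) maps necklace trajectories to billiard trajectories in $Q$. Every periodic billiard trajectory is the folding of a lift to the necklace of a periodic trajectory $p$ on the double pentagon; the corresponding cutting word is the sequence of glued edges of the double pentagon crossed by $p$ in one primitive period. There are two cylinders (maximal parallel families) of periodic billiard trajectories parallel to the sides of the pentagon; the central trajectory in the shorter one (joining midpoints of adjacent sides) is the mini pentagon and the central trajectory in the longer one (joining midpoints of non-adjacent sides) is the star. Order $5$ rotational symmetry means invariance, as a subset of $Q$, under rotation by $2\pi/5$ about the center. *)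

theory Defs
  imports "HOL-Analysis.Analysis"
begin

text \<open>The table is the regular pentagon centered at the origin with one vertex at \<open>a\<close>;
  vertices and sides are indexed modulo 5.\<close>

definition vertex :: "complex \<Rightarrow> nat \<Rightarrow> complex" where
  "vertex a k = a * cis (2 * pi * real k / 5)"

definition side :: "complex \<Rightarrow> nat \<Rightarrow> complex set" where
  "side a k = closed_segment (vertex a k) (vertex a (k + 1))"

definition side_mid :: "complex \<Rightarrow> nat \<Rightarrow> complex" where
  "side_mid a k = midpoint (vertex a k) (vertex a (k + 1))"

definition table :: "complex \<Rightarrow> complex set" where
  "table a = convex hull (range (vertex a))"

definition table_sides :: "complex \<Rightarrow> complex set set" where
  "table_sides a = range (side a)"

definition has_horizontal_side :: "complex \<Rightarrow> bool" where
  "has_horizontal_side a \<longleftrightarrow> (\<exists>k. Im (vertex a k) = Im (vertex a (k + 1)))"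

text \<open>For \<open>d \<noteq> 0\<close> this is the reflection in the line through the origin spanned by \<open>d\<close>,
  since \<open>d / cnj d = cis (2 * Arg d)\<close>.\<close>

definition refl_dir :: "complex \<Rightarrow> complex \<Rightarrow> complex" where
  "refl_dir d z = (d / cnj d) * cnj z"

definition side_refl :: "complex \<Rightarrow> nat \<Rightarrow> complex \<Rightarrow> complex" where
  "side_refl a k = refl_dir (vertex a (k + 1) - vertex a k)"

text \<open>The generators are involutions, so the monoid they generate is the group.\<close>

inductive_set dihedral :: "complex \<Rightarrow> (complex \<Rightarrow> complex) set" for a where
  id_mem: "id \<in> dihedral a"
| comp_mem: "g \<in> dihedral a \<Longrightarrow> g \<circ> side_refl a k \<in> dihedral a"

definition is_period :: "(int \<Rightarrow> 'a) \<Rightarrow> nat \<Rightarrow> bool" where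
  "is_period f n \<longleftrightarrow> n > 0 \<and> (\<forall>k. f (k + int n) = f k)"

definition periodic :: "(int \<Rightarrow> 'a) \<Rightarrow> bool" where
  "periodic f \<longleftrightarrow> (\<exists>n. is_period f n)"

definition primitive_period :: "(int \<Rightarrow> 'a) \<Rightarrow> nat" where
  "primitive_period f = (LEAST n. is_period f n)"

text \<open>A billiard trajectory is given by its successive bounce points, none of which is a
  vertex. The segments run through the interior of the table, and at each bounce the unit
  direction is reflected in the direction of the side that is hit.\<close>

definition billiard_trajectory :: "complex \<Rightarrow> (int \<Rightarrow> complex) \<Rightarrow> bool" where
  "billiard_trajectory a b \<longleftrightarrow>
     (\<forall>n. open_segment (b n) (b (n + 1)) \<subseteq> interior (table a)) \<and>
     (\<forall>n. \<exists>k. b n \<in> rel_interior (side a k) \<and>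
        sgn (b (n + 1) - b n) = side_refl a k (sgn (b n - b (n - 1))))"

definition trajectory_set :: "(int \<Rightarrow> complex) \<Rightarrow> complex set" where
  "trajectory_set b = (\<Union>n. closed_segment (b n) (b (n + 1)))"

definition rotation5_symmetric :: "complex set \<Rightarrow> bool" where
  "rotation5_symmetric T \<longleftrightarrow> (\<lambda>z. cis (2 * pi / 5) * z) ` T = T"

definition billiard_sequence :: "complex \<Rightarrow> (int \<Rightarrow> complex) \<Rightarrow> complex set list" where
  "billiard_sequence a b =
     map (\<lambda>n. THE e. e \<in> table_sides a \<and> b (int n) \<in> rel_interior e)
       [0..<primitive_period b]"

definition mini_pentagon :: "complex \<Rightarrow> (int \<Rightarrow> complex) \<Rightarrow> bool" where
  "mini_pentagon a b \<longleftrightarrow>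
     billiard_trajectory a b \<and> (\<forall>n. \<exists>k. {b n, b (n + 1)} = {side_mid a k, side_mid a (k + 1)})"

text \<open>Two distinct sides of a pentagon are non-adjacent iff their indices differ by 2
  modulo 5, in one of the two orders.\<close>

definition star :: "complex \<Rightarrow> (int \<Rightarrow> complex) \<Rightarrow> bool" where
  "star a b \<longleftrightarrow>
     billiard_trajectory a b \<and> (\<forall>n. \<exists>k. {b n, b (n + 1)} = {side_mid a k, side_mid a (k + 2)})"

text \<open>A surface is the disjoint union, over the sheets \<open>i\<close>, of plane polygons \<open>polygon i\<close>,
  with sides identified by translations. \<open>glued (i, E) (j, F)\<close> says that side \<open>E\<close> of sheet
  \<open>i\<close> is identified with side \<open>F\<close> of sheet \<open>j\<close>; the gluing map is the translation
  taking \<open>E\<close> to \<open>F\<close>.\<close>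

record 'i surface =
  sheets :: "'i set"
  polygon :: "'i \<Rightarrow> complex set"
  sides :: "'i \<Rightarrow> complex set set"
  glued :: "'i \<times> complex set \<Rightarrow> 'i \<times> complex set \<Rightarrow> bool"

text \<open>All sides of \<open>g ` Q\<close> (\<open>g\<close> in the dihedral group) have the same length, so
  two of them are parallel iff they are translates of each other.\<close>

definition translate_of :: "complex set \<Rightarrow> complex set \<Rightarrow> bool" where
  "translate_of E F \<longleftrightarrow> (\<exists>t. F = (+) t ` E)"

text \<open>\<open>crosses S \<theta> (i, x) (j, z)\<close>: the straight line in direction \<open>\<theta>\<close> entering sheet
  \<open>i\<close> at the boundary point \<open>x\<close> runs through the interior, leaves it at a point \<open>y\<close>
  in the relative interior of a side, and thereby enters sheet \<open>j\<close> at \<open>z\<close>.\<close>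

definition crosses :: "'i surface \<Rightarrow> complex \<Rightarrow> 'i \<times> complex \<Rightarrow> 'i \<times> complex \<Rightarrow> bool" where
  "crosses S \<theta> = (\<lambda>(i, x) (j, z). i \<in> sheets S \<and> j \<in> sheets S \<and>
     (\<exists>E F r t. E \<in> sides S i \<and> F \<in> sides S j \<and> glued S (i, E) (j, F) \<and> F = (+) t ` E \<and>
        r > 0 \<and> x + of_real r * \<theta> \<in> rel_interior E \<and>
        open_segment x (x + of_real r * \<theta>) \<subseteq> interior (polygon S i) \<and>
        z = x + of_real r * \<theta> + t))"

text \<open>A bi-infinite straight trajectory avoiding the vertices is recorded by its successive
  (sheet, entry point) pairs.\<close>

definition surface_trajectory :: "'i surface \<Rightarrow> (int \<Rightarrow> 'i \<times> complex) \<Rightarrow> bool" where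
  "surface_trajectory S p \<longleftrightarrow> (\<exists>\<theta>. \<theta> \<noteq> 0 \<and> (\<forall>n. crosses S \<theta> (p n) (p (n + 1))))"

definition glued_edge :: "'i surface \<Rightarrow> 'i \<times> complex \<Rightarrow> ('i \<times> complex set) set" where
  "glued_edge S = (\<lambda>(i, x).
     let E = (THE E. E \<in> sides S i \<and> x \<in> rel_interior E)
     in insert (i, E) {(j, F). glued S (i, E) (j, F)})"

definition cutting_word ::
    "'i surface \<Rightarrow> (int \<Rightarrow> 'i \<times> complex) \<Rightarrow> ('i \<times> complex set) set list" where
  "cutting_word S p = map (\<lambda>n. glued_edge S (p (int n))) [0..<primitive_period p]"

definition double_pentagon :: "complex \<Rightarrow> complex set surface" where
  "double_pentagon a = \<lparr>
     sheets = {table a, uminus ` table a},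
     polygon = (\<lambda>P. P),
     sides = (\<lambda>P. if P = table a then table_sides a else (`) uminus ` table_sides a),
     glued = (\<lambda>(P, E) (P', F).
       (P = table a \<and> E \<in> table_sides a \<and>
          P' = uminus ` table a \<and> F \<in> (`) uminus ` table_sides a \<or>
        P = uminus ` table a \<and> E \<in> (`) uminus ` table_sides a \<and>
          P' = table a \<and> F \<in> table_sides a) \<and>
       translate_of E F) \<rparr>"

definition necklace :: "complex \<Rightarrow> (complex \<Rightarrow> complex) surface" where
  "necklace a = \<lparr>
     sheets = dihedral a,
     polygon = (\<lambda>g. g ` table a),
     sides = (\<lambda>g. (`) g ` table_sides a),
     glued = (\<lambda>(g, E) (h, F). g \<in> dihedral a \<and>
       (\<exists>k. E = g ` side a k \<and> h = g \<circ> side_refl a k) \<and>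
       F \<in> (`) h ` table_sides a \<and> translate_of E F) \<rparr>"

text \<open>The covering sends the copy \<open>g ` Q\<close> identically onto \<open>Q\<close> or \<open>-Q\<close>, whichever it
  equals.\<close>

definition covering ::
    "complex \<Rightarrow> (complex \<Rightarrow> complex) \<times> complex \<Rightarrow> complex set \<times> complex" where
  "covering a = (\<lambda>(g, x). (g ` table a, x))"

definition folding :: "(complex \<Rightarrow> complex) \<times> complex \<Rightarrow> complex" where
  "folding = (\<lambda>(g, x). inv g x)"

text \<open>The billiard trajectory \<open>b\<close> is the folding of a lift to the necklace of the periodic
  trajectory \<open>p\<close> on the double pentagon.\<close>

definition corresponds ::
    "complex \<Rightarrow> (int \<Rightarrow> complex set \<times> complex) \<Rightarrow> (int \<Rightarrow> complex) \<Rightarrow> bool" where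
  "corresponds a p b \<longleftrightarrow>
     surface_trajectory (double_pentagon a) p \<and> periodic p \<and>
     (\<exists>L. surface_trajectory (necklace a) L \<and>
        (\<forall>n. p n = covering a (L n)) \<and> (\<forall>n. b n = folding (L n)))"

end

theory Submission
  imports Defs
begin

text \<open>
  Write \<open>g n\<close> for the sheets of the necklace met by the lift of \<open>\<tau>\<close>. They alternate between
  rotations and reflections, and \<open>g n\<close> takes the velocity of \<open>\<tau>\<close> at step \<open>n\<close> to the fixed
  direction of the lift. Let \<open>N\<close> and \<open>M\<close> be the primitive periods of \<open>\<tau>\<close> and \<open>p\<close>.
  Each copy of the pentagon is \<open>Q\<close> or \<open>-Q\<close>, so \<open>M\<close> is even, and after \<open>M\<close> steps \<open>\<tau>\<close> is
  rotated by some \<open>\<sigma>\<close> with \<open>\<sigma>^5 = 1\<close>; hence \<open>N\<close> divides \<open>5 * M\<close>. Conversely an even shift that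
  rotates \<open>\<tau>\<close> is a period of \<open>p\<close>. Rotational symmetry provides an even shift that rotates
  \<open>\<tau>\<close> by \<open>2 * \<pi> / 5\<close> (a shift reversing time is impossible, as its square would fix \<open>\<tau>\<close>), so
  \<open>\<sigma> \<noteq> 1\<close> and \<open>N\<close> does not divide \<open>M\<close>. If \<open>N\<close> is even, \<open>M\<close> divides \<open>N\<close> and \<open>N = 5 * M\<close>; if \<open>N\<close>
  is odd, \<open>M\<close> divides \<open>2 * N\<close> and \<open>2 * N = 5 * M\<close>.

  An odd period forces every velocity to be reversed by a reflection that preserves \<open>Q\<close>. Each
  chord is then symmetric, which makes every bounce point the midpoint of its side, and a
  trajectory through midpoints has constant ratio \<open>\<tau> (n + 1) / \<tau> n\<close>: it is the mini pentagon
  or the star, and these have period 5.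
\<close>

section \<open>Fifth roots of unity\<close>

definition omega :: complex ("\<omega>") where "\<omega> = cis (2 * pi / 5)"

lemma omega_pow5: "\<omega> ^ 5 = 1"
  by (simp add: omega_def Complex.DeMoivre)

lemma omega_pow: "\<omega> ^ k = cis (2 * pi * real k / 5)"
  by (simp add: omega_def Complex.DeMoivre mult_ac)

lemma norm_omega [simp]: "norm \<omega> = 1"
  by (simp add: omega_def)

lemma fifth_root_norm:
  fixes c :: complex
  assumes "c ^ 5 = 1"
  shows "norm c = 1" 
  using assms by (metis norm_one norm_power norm_ge_zero power_eq_1_iff zero_neq_numeral)

lemma fifth_root_cases:
  fixes c :: complex
  assumes "c ^ 5 = 1"
  obtains k where "k < 5" "c = \<omega> ^ k"
proof -
  have "c \<in> {z. z ^ 5 = 1}" using assms by simp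
  also have "\<dots> = (\<lambda>k. cis (2 * pi * real k / real (5::nat))) ` {..<5}"
    using Complex.bij_betw_roots_unity[of 5] by (simp add: bij_betw_def)
  finally show ?thesis using that by (auto simp: omega_pow)
qed

lemma Re_omega_bounds: "0 < Re \<omega>" "Re \<omega> < 1"
proof -
  show "0 < Re \<omega>" unfolding omega_def by (simp, rule cos_gt_zero_pi) (use pi_gt_zero in linarith)+
  have "cos (2 * pi / 5) < cos 0" by (rule cos_monotone_0_pi) (use pi_gt_zero in linarith)+
  then show "Re \<omega> < 1" by (simp add: omega_def)
qed

lemma omega_neq_1: "\<omega> \<noteq> 1"
  using Re_omega_bounds by auto

lemma fifth_root_inverse:
  fixes c :: complex
  assumes "c ^ 5 = 1"
  shows "c * cnj c = 1" "c \<noteq> 0" "cnj c ^ 5 = 1" "inverse c = cnj c"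
proof -
  show 1: "c * cnj c = 1" using fifth_root_norm[OF assms] by (simp add: complex_norm_square[symmetric])
  show "c \<noteq> 0" using assms by auto
  show "cnj c ^ 5 = 1" using assms by (metis complex_cnj_one complex_cnj_power)
  show "inverse c = cnj c" using 1 by (simp add: inverse_unique)
qed

lemma Re_omega_2: "Re (\<omega>^2) \<le> 0"
proof -
  have "cos (4*pi/5) \<le> cos (pi/2)" by (rule cos_monotone_0_pi_le) (use pi_gt_zero in linarith)+
  then show ?thesis unfolding omega_pow by (simp add: mult.commute)
qed

lemma omega_34: "Re (\<omega> ^ 3) = Re (\<omega>^2)" "\<omega>^4 = cnj \<omega>"
proof -
  have i: "inverse \<omega> = cnj \<omega>" "\<omega> \<noteq> 0" using fifth_root_inverse omega_pow5 by blast+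
  have "\<omega>^4 * \<omega> = 1" using omega_pow5 by (simp add: eval_nat_numeral mult_ac)
  then show "\<omega>^4 = cnj \<omega>" using i by (metis inverse_unique mult.commute)
  have "\<omega>^3 * \<omega>^2 = 1" using omega_pow5 by (simp add: eval_nat_numeral mult_ac)
  then have "\<omega>^3 = inverse (\<omega>^2)" by (metis inverse_unique mult.commute)
  then have "\<omega>^3 = (cnj \<omega>)^2" using i by (metis power_inverse)
  then show "Re (\<omega>^3) = Re (\<omega>^2)" by (simp add: power2_eq_square)
qed

text \<open>Among the roots other than 1, \<open>\<omega>\<close> and its conjugate are nearest to
  1. This gap keeps neighbouring sides apart and holds all vertices within each side line.\<close>

lemma Re_fifth_root_le:
  fixes c :: complex
  assumes "c ^ 5 = 1" "c \<noteq> 1"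
  shows "Re c \<le> Re \<omega>"
proof -
  obtain k where k: "k < 5" "c = \<omega> ^ k" using assms(1) by (rule fifth_root_cases)
  then have "k = 0 \<or> k = 1 \<or> k = 2 \<or> k = 3 \<or> k = 4" by linarith
  then show ?thesis using k assms(2) Re_omega_bounds Re_omega_2 omega_34 by auto
qed

text \<open>This is the real part of the vanishing sum of the fifth roots of unity, conjugate roots
  contributing equally. It will separate the pentagon from its negative.\<close>

lemma Re_omega_sum: "2 * Re \<omega> + 2 * Re (\<omega>^2) = -1"
proof -
  have "(1 + \<omega> + \<omega>^2 + \<omega>^3 + \<omega>^4) * (\<omega> - 1) = \<omega>^5 - 1"
    by (simp add: algebra_simps eval_nat_numeral)
  then have "1 + \<omega> + \<omega>^2 + \<omega>^3 + \<omega>^4 = 0" using omega_pow5 omega_neq_1 by simp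
  then have "Re (1 + \<omega> + \<omega>^2 + \<omega>^3 + \<omega>^4) = 0" by simp
  then show ?thesis using omega_34 by simp
qed

section \<open>The regular pentagon\<close>

lemma vertex_eq: "vertex a k = a * \<omega> ^ k"
  by (simp add: vertex_def omega_pow)

lemma omega_power_pow5: "(\<omega> ^ k) ^ 5 = 1"
proof -
  have "(\<omega> ^ k) ^ 5 = (\<omega> ^ 5) ^ k" by (metis power_mult mult.commute)
  then show ?thesis by (simp add: omega_pow5)
qed

lemma fifth_roots_eq: "{c. c ^ 5 = 1} = range ((^) \<omega>)"
proof (intro equalityI subsetI)
  fix c :: complex assume "c \<in> {c. c ^ 5 = 1}"
  then have "c ^ 5 = 1" by simp
  then obtain k where "c = \<omega> ^ k" by (rule fifth_root_cases)
  then show "c \<in> range ((^) \<omega>)" by simp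
next
  fix c assume "c \<in> range ((^) \<omega>)"
  then obtain k where "c = \<omega> ^ k" by (elim imageE)
  then show "c \<in> {c. c ^ 5 = 1}" using omega_power_pow5[of k] by simp
qed

lemma range_vertex: "range (vertex a) = (*) a ` {c. c ^ 5 = 1}"
  unfolding fifth_roots_eq image_image by (simp add: vertex_eq)

section \<open>Sides in terms of their midpoints\<close>

lemma side_mid_0: "side_mid a 0 = a * (1 + \<omega>) / 2"
  by (simp add: side_mid_def vertex_eq midpoint_def scaleR_conv_of_real algebra_simps)

lemma side_mid_eq: "side_mid a k = side_mid a 0 * \<omega> ^ k"
  by (simp add: side_mid_def vertex_eq midpoint_def scaleR_conv_of_real algebra_simps)

text \<open>Sides are named by their midpoints. These form one orbit under the fifth roots of unity,
  so symmetries act on the names directly, without index arithmetic modulo 5.\<close>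

definition mids :: "complex \<Rightarrow> complex set" where
  "mids a = range (side_mid a)"

lemma mids_eq: "mids a = (*) (side_mid a 0) ` {c. c ^ 5 = 1}"
  unfolding fifth_roots_eq image_image mids_def by (intro image_cong refl side_mid_eq)

text \<open>This is \<open>tan (\<pi>/5)\<close>, half a side length in units of the apothem: the points of the
  side with midpoint \<open>m\<close> are \<open>m * (1 + \<i> * t)\<close> with \<open>\<bar>t\<bar> \<le> half_side\<close>.\<close>

definition half_side :: real where
  "half_side = Im \<omega> / (1 + Re \<omega>)"

lemma Im_omega: "Im \<omega> = half_side * (1 + Re \<omega>)"
proof -
  have "1 + Re \<omega> \<noteq> 0" using Re_omega_bounds by linarith
  then show ?thesis unfolding half_side_def by (metis nonzero_eq_divide_eq)
qed

text \<open>The half-angle formula tan^2(x/2) = (1 - cos x) / (1 + cos x) at x = 2 pi / 5, with the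
  denominator cleared.\<close>

lemma half_side_sq: "half_side\<^sup>2 * (1 + Re \<omega>) = 1 - Re \<omega>"
proof -
  have nz: "1 + Re \<omega> \<noteq> 0" using Re_omega_bounds by linarith
  have "(Re \<omega>)\<^sup>2 + (Im \<omega>)\<^sup>2 = 1" using norm_omega by (metis cmod_power2 one_power2)
  with Im_omega have "(1 + Re \<omega>) * (half_side\<^sup>2 * (1 + Re \<omega>)) = (1 + Re \<omega>) * (1 - Re \<omega>)" 
    by algebra
  then show ?thesis using nz by (metis mult_left_cancel)
qed

lemma half_side_neq_0: "half_side \<noteq> 0"
  using half_side_sq Re_omega_bounds by auto

text \<open>Sum and difference of two unit vectors are orthogonal, so the quotient of
  \<open>\<omega> - 1\<close> by \<open>1 + \<omega>\<close> is purely imaginary.\<close>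

lemma omega_half_side: "\<omega> - 1 = (1 + \<omega>) * (\<i> * half_side)"
proof (rule complex_eqI)
  show "Re (\<omega> - 1) = Re ((1 + \<omega>) * (\<i> * half_side))"
    using half_side_sq Im_omega by (simp, algebra)
  show "Im (\<omega> - 1) = Im ((1 + \<omega>) * (\<i> * half_side))"
    using Im_omega by (simp add: mult.commute)
qed

lemma side_ends:
  "vertex a k = side_mid a k * (1 - \<i> * half_side)"
  "vertex a (k + 1) = side_mid a k * (1 + \<i> * half_side)"
proof -
  have m: "2 * side_mid a k = a * \<omega> ^ k * (1 + \<omega>)"
    by (simp add: side_mid_def vertex_eq midpoint_def scaleR_conv_of_real algebra_simps)
  have "2 * side_mid a k * (\<i> * half_side) = a * \<omega> ^ k * (\<omega> - 1)"
    unfolding m omega_half_side by simp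
  then have d: "2 * (side_mid a k * (\<i> * half_side)) = a * \<omega> ^ k * (\<omega> - 1)" by (simp add: mult.assoc)
  have "2 * vertex a k = 2 * (side_mid a k * (1 - \<i> * half_side))"
    "2 * vertex a (k + 1) = 2 * (side_mid a k * (1 + \<i> * half_side))"
    unfolding right_diff_distrib[of "side_mid a k"] distrib_left[of "side_mid a k"]
      right_diff_distrib[of 2] distrib_left[of 2] d m mult_1_right
    by (simp_all add: vertex_eq algebra_simps)
  then show "vertex a k = side_mid a k * (1 - \<i> * half_side)"
    "vertex a (k + 1) = side_mid a k * (1 + \<i> * half_side)"
    by simp_all
qed

lemma side_segment:
  "side a k = closed_segment (side_mid a k * (1 - \<i> * half_side)) (side_mid a k * (1 + \<i> * half_side))"
  unfolding side_def side_ends(1)[of a k] side_ends(2)[of a k] ..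

text \<open>Coordinates for the relative interior of the side with midpoint \<open>m\<close>.
  Comparing squares avoids having to know the sign of \<open>half_side\<close>.\<close>

definition on_side :: "complex \<Rightarrow> complex \<Rightarrow> complex \<Rightarrow> bool" where
  "on_side a m z \<longleftrightarrow> m \<in> mids a \<and> (\<exists>t. t\<^sup>2 < half_side\<^sup>2 \<and> z = m * (1 + \<i> * of_real t))"

text \<open>For \<open>m \<noteq> 0\<close>, the reflection in the line through the origin
  perpendicular to \<open>m\<close>: it negates \<open>m\<close> and fixes
  \<open>\<i> * m\<close>.\<close>

definition mirror :: "complex \<Rightarrow> complex \<Rightarrow> complex" where
  "mirror m z = - (m / cnj m) * cnj z"

locale pentagon =
  fixes a :: complex
  assumes a_neq_0: "a \<noteq> 0"
begin

lemma mid0_neq_0: "side_mid a 0 \<noteq> 0"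
proof 
  assume "side_mid a 0 = 0"
  then have "vertex a 0 = 0" using side_ends(1)[of a 0] by simp
  then show False using a_neq_0 by (simp add: vertex_eq)
qed

lemma norm_mids: "m \<in> mids a \<Longrightarrow> norm m = norm (side_mid a 0)"
  by (auto simp: mids_eq norm_mult fifth_root_norm)

lemma mids_neq_0: "m \<in> mids a \<Longrightarrow> m \<noteq> 0"
  using norm_mids mid0_neq_0 by fastforce

lemma side_mid_mem: "side_mid a k \<in> mids a"
  by (simp add: mids_def)

text \<open>The direction of a side is \<open>\<i>\<close> times a real multiple of its midpoint,
  and \<open>\<i> / cnj \<i> = - 1\<close> produces the sign in \<open>mirror\<close>.\<close>

lemma side_refl_eq: "side_refl a k z = mirror (side_mid a k) z"
proof -
  have d: "vertex a (k+1) - vertex a k = side_mid a k * (2 * \<i> * half_side)"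
    unfolding side_ends(1)[of a k] side_ends(2)[of a k] by (simp add: algebra_simps)
  have "side_mid a k \<noteq> 0" using side_mid_mem mids_neq_0 by blast
  then show ?thesis
    unfolding side_refl_def refl_dir_def d mirror_def using half_side_neq_0 by simp
qed

lemma rel_interior_side: "rel_interior (side a k) = open_segment (vertex a k) (vertex a (k+1))"
proof -
  have "vertex a k \<noteq> vertex a (k+1)"
    unfolding side_ends(1)[of a k] side_ends(2)[of a k] using mids_neq_0[OF side_mid_mem[of k]] half_side_neq_0 by (auto simp: complex_eq_iff)
  then show ?thesis by (simp add: side_def rel_interior_closed_segment)
qed

lemma on_side_rel_interior:
  assumes "z \<in> rel_interior (side a k)"
  shows "on_side a (side_mid a k) z"
proof -
  obtain u where u: "0 < u" "u < 1" "z = (1 - u) *\<^sub>R vertex a k + u *\<^sub>R vertex a (k+1)"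
    using assms unfolding rel_interior_side in_segment by blast
  define t where "t = (2 * u - 1) * half_side"
  have "\<bar>2 * u - 1\<bar> < 1" using u by auto
  then have "(2 * u - 1)\<^sup>2 < 1" by (simp add: abs_square_less_1)
  then have "t\<^sup>2 < half_side\<^sup>2" 
    using half_side_neq_0 by (simp add: t_def power_mult_distrib)
  moreover have "z = side_mid a k * (1 + \<i> * of_real t)"
    unfolding u(3) side_ends(1)[of a k] side_ends(2)[of a k] t_def scaleR_conv_of_real by (simp add: algebra_simps)
  ultimately show ?thesis using side_mid_mem on_side_def by blast
qed

text \<open>Equal moduli leave \<open>t' = t\<close> or \<open>t' = - t\<close>. In the second case
  the quotient \<open>d\<close> of the two midpoints is a fifth root of unity with real part (1 -
  t^2) / (1 + t^2). The bound on \<open>t\<close> makes this exceed \<open>Re \<omega>\<close>, so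
  \<open>d = 1\<close> and then \<open>t = 0\<close>.\<close>

lemma side_param_unique:
  assumes "m \<in> mids a" "m' \<in> mids a" "t\<^sup>2 < half_side\<^sup>2"
    and e: "m * (1 + \<i> * of_real t) = m' * (1 + \<i> * of_real t')"
  shows "m = m' \<and> t = t'"
proof -
  have n: "norm (1 + \<i> * of_real s) ^ 2 = 1 + s\<^sup>2" for s :: real
    by (simp add: cmod_power2)
  have "norm m * norm (1 + \<i> * of_real t) = norm m' * norm (1 + \<i> * of_real t')"
    using e by (metis norm_mult)
  then have "norm (1 + \<i> * of_real t) = norm (1 + \<i> * of_real t')"
    unfolding norm_mids[OF assms(1)] norm_mids[OF assms(2)] using mid0_neq_0 by simp
  then have "1 + t\<^sup>2 = 1 + t'\<^sup>2" unfolding n[symmetric] by (rule arg_cong)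
  then have "t\<^sup>2 = t'\<^sup>2" by simp
  then have "t = t' \<or> t = - t'" by (simp only: power2_eq_iff)
  then have "t' = t \<or> t' = - t" by auto
  then show ?thesis
  proof
    assume "t' = t"
    moreover have "1 + \<i> * of_real t \<noteq> 0" by (simp add: complex_eq_iff)
    ultimately show ?thesis using e by simp
  next
    assume t': "t' = - t"
    obtain c c' where c: "c ^ 5 = 1" "m = side_mid a 0 * c" and c': "c' ^ 5 = 1" "m' = side_mid a 0 * c'"
      using assms by (auto simp: mids_eq)
    have e2: "c * (1 + \<i> * of_real t) = c' * (1 - \<i> * of_real t)"
      using e mid0_neq_0 unfolding c c' t' by simp
    define d where "d = c' * cnj c"
    have d5: "d ^ 5 = 1" unfolding d_def using c c' fifth_root_inverse(3) by (simp add: power_mult_distrib)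
    have "(1 + \<i> * of_real t) = cnj c * (c * (1 + \<i> * of_real t))"
      using fifth_root_inverse(1)[OF c(1)] by (simp flip: mult.assoc add: mult.commute)
    then have "(1 + \<i> * of_real t) = d * (1 - \<i> * of_real t)"
      unfolding e2 d_def by (simp add: mult_ac)
    then have "(1 + \<i> * of_real t) * (1 + \<i> * of_real t) = d * ((1 - \<i> * of_real t) * (1 + \<i> * of_real t))"
      by simp
    also have "(1 - \<i> * of_real t) * (1 + \<i> * of_real t) = of_real (1 + t\<^sup>2)"
      by (simp add: algebra_simps power2_eq_square)
    finally have "Re ((1 + \<i> * of_real t) * (1 + \<i> * of_real t)) = Re (d * of_real (1 + t\<^sup>2))" by presburger
    then have r: "1 - t\<^sup>2 = Re d * (1 + t\<^sup>2)" by (simp add: power2_eq_square)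
    have "d = 1"
    proof (rule ccontr)
      assume "d \<noteq> 1"
      then have "Re d \<le> Re \<omega>" using Re_fifth_root_le d5 by blast
      then have "1 - t\<^sup>2 \<le> Re \<omega> * (1 + t\<^sup>2)" unfolding r by (intro mult_right_mono) auto
      then have "1 - Re \<omega> \<le> t\<^sup>2 * (1 + Re \<omega>)" by (simp add: algebra_simps)
      moreover have "t\<^sup>2 * (1 + Re \<omega>) < half_side\<^sup>2 * (1 + Re \<omega>)"
        using assms(3) Re_omega_bounds by (intro mult_strict_right_mono) auto
      ultimately show False using half_side_sq by linarith
    qed
    then have "t\<^sup>2 = 0" using r by simp
    then have "t = 0" by simp
    then show ?thesis using e t' by simp
  qed
qed

lemma on_side_unique: "on_side a m z \<Longrightarrow> on_side a m' z \<Longrightarrow> m = m'"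
  unfolding on_side_def using side_param_unique by blast

section \<open>Half-planes bounding the table\<close>

lemma table_eq: "table a = convex hull ((*) a ` {c. c ^ 5 = 1})"
  by (simp add: table_def range_vertex)

lemma inner_eq_Re: "x \<bullet> y = Re (y * cnj x)" for x y :: complex
  by (simp add: inner_complex_def mult.commute)

text \<open>The midpoint is the mean of the vertices \<open>a * d\<close> and
  \<open>a * d * \<omega>\<close>, so each inner product is the mean of two cosines, scaled by
  \<open>(norm a)\<^sup>2\<close>.\<close>

lemma inner_mid:
  "(side_mid a 0 * d) \<bullet> (a * z) = (norm a)\<^sup>2 / 2 * (Re (z * cnj d) + Re (z * cnj d * cnj \<omega>))"
proof -
  have "(side_mid a 0 * d) \<bullet> (a * z) = Re (a * z * cnj (side_mid a 0 * d))"
    by (rule inner_eq_Re)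
  also have "a * z * cnj (side_mid a 0 * d) = (a * cnj a) * (z * cnj d + z * cnj d * cnj \<omega>) / 2"
    unfolding side_mid_0 by (simp add: algebra_simps)
  also have "\<dots> = of_real ((norm a)\<^sup>2 / 2) * (z * cnj d + z * cnj d * cnj \<omega>)"
    using complex_norm_square[of a] by simp
  also have "Re \<dots> = (norm a)\<^sup>2 / 2 * Re (z * cnj d + z * cnj d * cnj \<omega>)"
    by (simp only: Re_complex_of_real Im_complex_of_real times_complex.simps)
  finally show ?thesis by (simp only: plus_complex.simps)
qed

lemma norm_mid_sq:
  assumes "m \<in> mids a"
  shows "(norm m)\<^sup>2 = (norm a)\<^sup>2 / 2 * (1 + Re \<omega>)"
proof -
  have "(norm m)\<^sup>2 = (norm a)\<^sup>2 * (norm (1 + \<omega>))\<^sup>2 / 4"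
    unfolding norm_mids[OF assms] by (simp add: side_mid_0 norm_mult norm_divide power_mult_distrib power_divide)
  also have "(norm (1 + \<omega>))\<^sup>2 = 2 + 2 * Re \<omega>"
  proof -
    have "(Re \<omega>)\<^sup>2 + (Im \<omega>)\<^sup>2 = 1" using norm_omega by (metis cmod_power2 one_power2)
    then show ?thesis unfolding cmod_power2 by (simp add: power2_eq_square algebra_simps)
  qed
  finally show ?thesis by (simp add: field_simps)
qed

text \<open>The two cosines belong to fifth roots differing by a factor \<open>\<omega>\<close>. If
  one of the roots is 1, the vertex is an end of the side and equality holds; otherwise both cosines
  are at most \<open>Re \<omega>\<close>.\<close>

lemma vertex_inner_mid:
  assumes "c ^ 5 = 1" "m \<in> mids a"
  shows "m \<bullet> (a * c) \<le> (norm m)\<^sup>2"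
proof -
  obtain d where d: "d ^ 5 = 1" "m = side_mid a 0 * d" using assms by (auto simp: mids_eq)
  define e where "e = c * cnj d"
  have e5: "e ^ 5 = 1" unfolding e_def using assms d fifth_root_inverse(3) by (simp add: power_mult_distrib del: complex_cnj_power)
  have f5: "(e * cnj \<omega>) ^ 5 = 1" using e5 omega_pow5 fifth_root_inverse(3) by (simp add: power_mult_distrib)
  have "Re e + Re (e * cnj \<omega>) \<le> 1 + Re \<omega>"
  proof (cases "e = 1 \<or> e * cnj \<omega> = 1")
    case True
    then show ?thesis
    proof
      assume "e * cnj \<omega> = 1"
      then have "e = \<omega>" using fifth_root_inverse(1)[OF omega_pow5] fifth_root_inverse(2)[OF omega_pow5]
        by (metis complex_cnj_zero_iff mult_right_cancel)
      then show ?thesis using \<open>e * cnj \<omega> = 1\<close> by simp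
    qed simp
  next
    case False
    then have "Re e \<le> Re \<omega>" "Re (e * cnj \<omega>) \<le> Re \<omega>" using e5 f5 Re_fifth_root_le by blast+
    then show ?thesis using Re_omega_bounds by linarith
  qed
  then show ?thesis unfolding norm_mid_sq[OF assms(2)] unfolding d(2) inner_mid e_def by (intro mult_left_mono) auto
qed

lemma table_halfplane:
  assumes "m \<in> mids a"
  shows "table a \<subseteq> {z. m \<bullet> z \<le> (norm m)\<^sup>2}"
  unfolding table_eq using assms vertex_inner_mid 
  by (intro hull_minimal convex_halfspace_le) auto

text \<open>The side lies on the boundary line of a half-plane containing the table, while the
  interior of the table lies in the open half-plane.\<close>

lemma on_side_not_interior:
  assumes "on_side a m z"
  shows "z \<notin> interior (table a)"
proof
  assume "z \<in> interior (table a)"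
  have m: "m \<in> mids a" "m \<noteq> 0" using assms mids_neq_0 by (auto simp: on_side_def)
  then have "interior (table a) \<subseteq> {z. m \<bullet> z < (norm m)\<^sup>2}"
    using interior_mono[OF table_halfplane[OF m(1)]] by simp
  then have "m \<bullet> z < (norm m)\<^sup>2" using \<open>z \<in> interior (table a)\<close> by blast
  moreover obtain t where "z = m * (1 + \<i> * of_real t)" using assms by (auto simp: on_side_def)
  then have "m \<bullet> z = (norm m)\<^sup>2"
    unfolding cmod_power2 by (simp add: inner_complex_def power2_eq_square algebra_simps)
  ultimately show False by simp
qed

text \<open>Side 2 faces vertex 0, and \<open>- a\<close> sticks out beyond it: in units of
  \<open>(norm a)\<^sup>2 / 2\<close> the inner product with the midpoint is 1 + 2 cos(2 pi / 5),
  where the half-plane allows only 1 + cos(2 pi / 5).\<close>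

lemma minus_table_neq: "uminus ` table a \<noteq> table a"
proof
  assume "uminus ` table a = table a"
  moreover have "a \<in> table a" unfolding table_eq by (intro hull_inc) (auto intro: rev_image_eqI[of 1])
  ultimately have *: "- a \<in> table a" by blast
  have "side_mid a 2 \<bullet> (a * (- 1)) \<le> (norm (side_mid a 2))\<^sup>2"
  proof -
    have "- a \<in> {z. side_mid a 2 \<bullet> z \<le> (norm (side_mid a 2))\<^sup>2}"
      using * table_halfplane[OF side_mid_mem] by blast
    then show ?thesis by simp
  qed
  then have "(norm a)\<^sup>2 / 2 * (Re (- 1 * cnj (\<omega>\<^sup>2)) + Re (- 1 * cnj (\<omega>\<^sup>2) * cnj \<omega>))
      \<le> (norm a)\<^sup>2 / 2 * (1 + Re \<omega>)"
    unfolding norm_mid_sq[OF side_mid_mem] unfolding side_mid_eq[of a 2] inner_mid .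
  moreover have "(norm a)\<^sup>2 / 2 > 0" using a_neq_0 by simp
  ultimately have "Re (- 1 * cnj (\<omega>\<^sup>2)) + Re (- 1 * cnj (\<omega>\<^sup>2) * cnj \<omega>) \<le> 1 + Re \<omega>"
    using mult_le_cancel_left_pos by blast
  moreover have "- 1 * cnj (\<omega>\<^sup>2) * cnj \<omega> = - cnj (\<omega> ^ 3)"
    by (simp add: eval_nat_numeral)
  then have "Re (- 1 * cnj (\<omega>\<^sup>2) * cnj \<omega>) = - Re (\<omega>\<^sup>2)"
    using omega_34(1) by (simp only: uminus_complex.simps cnj.simps)
  moreover have "Re (- 1 * cnj (\<omega>\<^sup>2)) = - Re (\<omega>\<^sup>2)"
    by (simp only: mult_minus1 uminus_complex.simps cnj.simps)
  ultimately show False using Re_omega_sum Re_omega_bounds by linarith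
qed

section \<open>Linear symmetries of the table\<close>

lemma image_table:
  assumes f: "linear f" and "f ` ((*) a ` {c. c ^ 5 = 1}) = (*) a ` {c. c ^ 5 = 1}"
  shows "f ` table a = table a"
  unfolding table_eq by (simp only: convex_hull_linear_image[OF f] assms(2))

lemma rotation_table:
  assumes "c ^ 5 = 1"
  shows "(*) c ` table a = table a"
proof (rule image_table)
  show "linear ((*) c)" by (simp add: bounded_linear.linear bounded_linear_mult_right)
  have "a * d \<in> (*) c ` ((*) a ` {c. c ^ 5 = 1})" if "d ^ 5 = 1" for d
    using fifth_root_inverse[OF assms] that
    by (intro image_eqI[of _ _ "a * (cnj c * d)"] imageI) (auto simp: power_mult_distrib mult_ac)
  then show "(*) c ` ((*) a ` {c. c ^ 5 = 1}) = (*) a ` {c. c ^ 5 = 1}"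
    using assms by (auto simp: power_mult_distrib mult.left_commute)
qed

text \<open>For \<open>c = 1\<close> this is the reflection in the axis through the vertex
  \<open>a\<close>; the other values of \<open>c\<close> give the remaining axes of the
  pentagon.\<close>

lemma reflection_table:
  assumes "c ^ 5 = 1"
  shows "(\<lambda>z. (a / cnj a) * c * cnj z) ` table a = table a"
proof (rule image_table)
  show "linear (\<lambda>z. (a / cnj a) * c * cnj z)" by (auto intro!: linearI simp: algebra_simps add_divide_distrib scaleR_conv_of_real)
  have 1: "(a / cnj a) * c * cnj (a * d) = a * (c * cnj d)" for d using a_neq_0 by simp
  have "a * d \<in> (\<lambda>z. (a / cnj a) * c * cnj z) ` ((*) a ` {c. c ^ 5 = 1})" if "d ^ 5 = 1" for d
  proof (rule image_eqI)
    have "c * cnj (c * cnj d) = (c * cnj c) * d" by simp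
    then have "c * cnj (c * cnj d) = d" using fifth_root_inverse(1)[OF assms] by simp
    then show "a * d = (a / cnj a) * c * cnj (a * (c * cnj d))" unfolding 1 by simp
    have "(c * cnj d) ^ 5 = 1"
      unfolding power_mult_distrib assms fifth_root_inverse(3)[OF that] by simp
    then show "a * (c * cnj d) \<in> (*) a ` {c. c ^ 5 = 1}" by blast
  qed
  moreover have "(a / cnj a) * c * cnj (a * d) \<in> (*) a ` {c. c ^ 5 = 1}" if "d ^ 5 = 1" for d
    unfolding 1 using assms that fifth_root_inverse(3)[OF that] by (auto simp: power_mult_distrib)
  ultimately show "(\<lambda>z. (a / cnj a) * c * cnj z) ` (*) a ` {c. c ^ 5 = 1} = (*) a ` {c. c ^ 5 = 1}"
    by blast
qed

end

section \<open>Billiard trajectories\<close>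

lemma between_in_open_segment:
  fixes u d :: "'a::real_vector"
  assumes "d \<noteq> 0" "\<alpha> < \<tau> \<and> \<tau> < \<beta> \<or> \<beta> < \<tau> \<and> \<tau> < \<alpha>"
  shows "u + \<tau> *\<^sub>R d \<in> open_segment (u + \<alpha> *\<^sub>R d) (u + \<beta> *\<^sub>R d)"
proof -
  define v where "v = (\<tau> - \<alpha>) / (\<beta> - \<alpha>)"
  have v: "0 < v" "v < 1" using assms(2) by (auto simp: v_def field_simps)
  have "\<tau> = \<alpha> + v * (\<beta> - \<alpha>)" using assms(2) by (auto simp: v_def)
  moreover have "u + (\<alpha> + v * (\<beta> - \<alpha>)) *\<^sub>R d = (1 - v) *\<^sub>R (u + \<alpha> *\<^sub>R d) + v *\<^sub>R (u + \<beta> *\<^sub>R d)"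
    by (simp add: algebra_simps)
  ultimately have "u + \<tau> *\<^sub>R d = (1 - v) *\<^sub>R (u + \<alpha> *\<^sub>R d) + v *\<^sub>R (u + \<beta> *\<^sub>R d)" by simp
  moreover have "u + \<alpha> *\<^sub>R d \<noteq> u + \<beta> *\<^sub>R d" using assms by auto
  ultimately show ?thesis using v in_segment(2) by blast
qed

text \<open>If the endpoints differed, the nearer one would lie in the open segment to the farther
  one, hence in \<open>I\<close>.\<close>

lemma open_segment_endpoint_unique:
  fixes x y y' :: "'a::real_normed_vector"
  assumes "y \<noteq> x" "y' \<noteq> x" "sgn (y - x) = sgn (y' - x)"
    and "open_segment x y \<subseteq> I" "open_segment x y' \<subseteq> I" "y \<notin> I" "y' \<notin> I"
  shows "y = y'"
proof -
  define d where "d = sgn (y - x)"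
  have d: "d \<noteq> 0" using assms(1) by (simp add: d_def sgn_zero_iff)
  have *: "z = x + norm (z - x) *\<^sub>R sgn (z - x)" if "z \<noteq> x" for z
    using that by (simp add: sgn_div_norm)
  have y: "y = x + norm (y - x) *\<^sub>R d" using *[OF assms(1)] by (simp add: d_def)
  have y': "y' = x + norm (y' - x) *\<^sub>R d" using *[OF assms(2)] by (simp add: d_def assms(3))
  have pos: "norm (y - x) > 0" "norm (y' - x) > 0" using assms(1,2) by simp_all
  have "\<not> norm (y - x) < norm (y' - x)"
    using between_in_open_segment[OF d, of 0 "norm (y - x)" "norm (y' - x)" x] y y' pos assms(5,6) by auto
  moreover have "\<not> norm (y' - x) < norm (y - x)"
    using between_in_open_segment[OF d, of 0 "norm (y' - x)" "norm (y - x)" x] y y' pos assms(4,7) by auto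
  ultimately show ?thesis using y y' by (metis linorder_neqE_linordered_idom)
qed

text \<open>Two common points put both chords on one line, where they are intervals overlapping at
  \<open>p\<close>. No endpoint of one lies strictly inside the other, since endpoints avoid
  \<open>I\<close> and open chords lie in it. So the intervals coincide, possibly reversed.\<close>

lemma chord_unique:
  fixes A B C D :: "'a::real_vector"
  assumes "A \<noteq> B" "open_segment A B \<subseteq> I" "open_segment C D \<subseteq> I"
    and out: "A \<notin> I" "B \<notin> I" "C \<notin> I" "D \<notin> I"
    and "p \<noteq> q" and p: "p \<in> open_segment A B" "p \<in> closed_segment C D"
    and q: "q \<in> open_segment A B" "q \<in> closed_segment C D"
  shows "C = A \<and> D = B \<or> C = B \<and> D = A"
proof -
  define d where "d = B - A"
  have d: "d \<noteq> 0" using assms(1) by (simp add: d_def)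
  have A: "A = A + 0 *\<^sub>R d" and B: "B = A + 1 *\<^sub>R d" by (simp_all add: d_def)
  obtain s where s: "0 < s" "s < 1" "p = A + s *\<^sub>R d"
    using p(1) by (auto simp: in_segment d_def algebra_simps)
  obtain s' where s': "q = A + s' *\<^sub>R d"
    using q(1) by (auto simp: in_segment d_def algebra_simps)
  obtain x where x: "0 \<le> x" "x \<le> 1" "p = C + x *\<^sub>R (D - C)"
    using p(2) by (auto simp: in_segment algebra_simps)
  obtain y where y: "q = C + y *\<^sub>R (D - C)"
    using q(2) by (auto simp: in_segment algebra_simps)
  have "p - q = (s - s') *\<^sub>R d" unfolding s s' by (simp add: algebra_simps)
  moreover have "p - q = (x - y) *\<^sub>R (D - C)" unfolding x y by (simp add: algebra_simps)
  ultimately have e: "(x - y) *\<^sub>R (D - C) = (s - s') *\<^sub>R d" by simp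
  have "x \<noteq> y" using \<open>p \<noteq> q\<close> x y by auto
  define \<kappa> where "\<kappa> = (s - s') / (x - y)"
  have "D - C = (1 / (x - y)) *\<^sub>R ((x - y) *\<^sub>R (D - C))" using \<open>x \<noteq> y\<close> by simp
  then have DC: "D - C = \<kappa> *\<^sub>R d" unfolding e \<kappa>_def by simp
  \<comment> \<open>\<open>\<alpha>\<close> and \<open>\<beta>\<close> are the parameters of
    \<open>C\<close> and \<open>D\<close> on the line where \<open>A\<close> has parameter 0 and
    \<open>B\<close> has parameter 1.\<close>
  define \<alpha> where "\<alpha> = s - x * \<kappa>"
  define \<beta> where "\<beta> = \<alpha> + \<kappa>"
  have "C = p - x *\<^sub>R (\<kappa> *\<^sub>R d)" using x(3) DC by simp
  then have C: "C = A + \<alpha> *\<^sub>R d" unfolding s(3) \<alpha>_def by (simp add: algebra_simps)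
  have D: "D = A + \<beta> *\<^sub>R d" using C DC unfolding \<beta>_def by (simp add: algebra_simps)
  have "p \<in> I" using p assms(2) by blast
  then have "p \<noteq> C" "p \<noteq> D" using out by auto
  then have "s \<noteq> \<alpha>" "s \<noteq> \<beta>" using C D s(3) by auto
  moreover have "s = (1 - x) * \<alpha> + x * \<beta>" unfolding \<beta>_def \<alpha>_def by (simp add: algebra_simps)
  then have "s - \<alpha> = x * (\<beta> - \<alpha>)" "\<beta> - s = (1 - x) * (\<beta> - \<alpha>)" by (simp_all add: algebra_simps)
  ultimately have betw: "\<alpha> < s \<and> s < \<beta> \<or> \<beta> < s \<and> s < \<alpha>"
    using x(1,2) by (smt (verit) mult_nonneg_nonneg mult_nonneg_nonpos)
  have "A + \<tau> *\<^sub>R d \<in> I" if "0 < \<tau>" "\<tau> < 1" for \<tau>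
    using between_in_open_segment[OF d, of 0 \<tau> 1 A] that A B assms(2) by auto
  then have 1: "\<not> (0 < \<alpha> \<and> \<alpha> < 1)" "\<not> (0 < \<beta> \<and> \<beta> < 1)" using C D out by auto
  have "A + \<tau> *\<^sub>R d \<in> I" if "\<alpha> < \<tau> \<and> \<tau> < \<beta> \<or> \<beta> < \<tau> \<and> \<tau> < \<alpha>" for \<tau>
    using between_in_open_segment[OF d that, of A] C D assms(3) by auto
  then have 2: "\<not> (\<alpha> < 0 \<and> 0 < \<beta> \<or> \<beta> < 0 \<and> 0 < \<alpha>)" "\<not> (\<alpha> < 1 \<and> 1 < \<beta> \<or> \<beta> < 1 \<and> 1 < \<alpha>)"
    using A B out by metis+
  from betw 1 2 s(1,2) have "\<alpha> = 0 \<and> \<beta> = 1 \<or> \<alpha> = 1 \<and> \<beta> = 0" by linarith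
  then show ?thesis using A B C D by auto
qed

text \<open>Eliminating \<open>Re u\<close> from the two unit-norm equations leaves
  \<open>r * (r - 1) * (norm u)\<^sup>2 = 0\<close>. Geometrically, a ray from the point 1 meets the
  unit circle at most once more.\<close>

lemma unit_ray:
  fixes w w' :: complex
  assumes "r > 0" "norm w = 1" "norm w' = 1" "w \<noteq> 1" "w' - 1 = of_real r * (w - 1)"
  shows "w' = w"
proof -
  define u where "u = w - 1"
  have n: "(norm (1 + of_real s * u))\<^sup>2 = 1 + 2 * s * Re u + s\<^sup>2 * (norm u)\<^sup>2" for s
    unfolding cmod_power2 by (simp add: power2_eq_square algebra_simps)
  have "w = 1 + of_real 1 * u" "w' = 1 + of_real r * u" by (simp_all add: u_def assms(5)[symmetric])
  then have "1 + 2 * Re u + (norm u)\<^sup>2 = 1" "1 + 2 * r * Re u + r\<^sup>2 * (norm u)\<^sup>2 = 1"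
    using n[of 1] n[of r] assms(2,3) by simp_all
  then have "r * (r - 1) * (norm u)\<^sup>2 = 0" by algebra
  then have "r = 1" using assms(1,4) by (simp add: u_def)
  then show ?thesis using assms(5) by simp
qed

section \<open>Shifts, reversal and rotations of trajectories\<close>

lemma mirror_mirror: "m \<noteq> 0 \<Longrightarrow> mirror m (mirror m z) = z"
  by (simp add: mirror_def)

lemma mirror_minus: "mirror m (- z) = - mirror m z"
  by (simp add: mirror_def)

lemma mirror_rotate:
  assumes "c ^ 5 = 1"
  shows "mirror (c * m) (c * z) = c * mirror m z"
proof -
  have "cnj c \<noteq> 0" using fifth_root_inverse(2)[OF assms] by simp
  then show ?thesis by (simp add: mirror_def)
qed

lemma sgn_rotate:
  fixes c :: complex
  assumes "c ^ 5 = 1"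
  shows "sgn (c * x - c * y) = c * sgn (x - y)"
  using fifth_root_norm[OF assms] by (simp add: sgn_div_norm norm_mult flip: right_diff_distrib)

text \<open>Unlike \<open>billiard_trajectory\<close>, this excludes constant sequences, for which \<open>sgn 0 = 0\<close> makes
  the reflection law vacuous.\<close>

definition traj :: "complex \<Rightarrow> (int \<Rightarrow> complex) \<Rightarrow> bool" where
  "traj a b \<longleftrightarrow>
     (\<forall>n. open_segment (b n) (b (n + 1)) \<subseteq> interior (table a)) \<and>
     (\<forall>n. b n \<noteq> b (n + 1)) \<and>
     (\<forall>n. \<exists>m. on_side a m (b n) \<and> sgn (b (n + 1) - b n) = mirror m (sgn (b n - b (n - 1))))"

lemma traj_shift:
  assumes "traj a b"
  shows "traj a (\<lambda>n. b (n + k))"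
  unfolding traj_def
proof (intro conjI allI)
  fix n
  have e: "n + 1 + k = (n + k) + 1" "n - 1 + k = (n + k) - 1" by simp_all
  show "open_segment (b (n + k)) (b (n + 1 + k)) \<subseteq> interior (table a)" "b (n + k) \<noteq> b (n + 1 + k)"
    "\<exists>m. on_side a m (b (n + k)) \<and> sgn (b (n + 1 + k) - b (n + k)) = mirror m (sgn (b (n + k) - b (n - 1 + k)))"
    unfolding e using assms by (auto simp: traj_def)
qed

context pentagon
begin

text \<open>\<open>mirror m\<close> is an involution commuting with negation, so the reflection law
  can be solved for the incoming direction and read backwards.\<close>

lemma traj_reverse:
  assumes "traj a b"
  shows "traj a (\<lambda>n. b (- n))"
  unfolding traj_def
proof (intro conjI allI)
  fix n
  have o: "open_segment (b (- n - 1)) (b (- n - 1 + 1)) \<subseteq> interior (table a)"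
    and d: "b (- n - 1) \<noteq> b (- n - 1 + 1)"
    using assms unfolding traj_def by blast+
  have e: "- (n + 1) = - n - 1" "- (n - 1) = - n + 1" by simp_all
  show "open_segment (b (- n)) (b (- (n + 1))) \<subseteq> interior (table a)"
    using o by (simp add: e open_segment_commute)
  show "b (- n) \<noteq> b (- (n + 1))" using d by (simp add: e)
  obtain m where m: "on_side a m (b (- n))"
    "sgn (b (- n + 1) - b (- n)) = mirror m (sgn (b (- n) - b (- n - 1)))"
    using assms unfolding traj_def by blast
  have "m \<noteq> 0" using m mids_neq_0 by (auto simp: on_side_def)
  then have "mirror m (sgn (b (- n + 1) - b (- n))) = sgn (b (- n) - b (- n - 1))"
    unfolding m(2) by (rule mirror_mirror)
  then have "- mirror m (sgn (b (- n + 1) - b (- n))) = - sgn (b (- n) - b (- n - 1))" by simp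
  then have "sgn (b (- (n + 1)) - b (- n)) = mirror m (sgn (b (- n) - b (- (n - 1))))"
    unfolding mirror_minus[symmetric] sgn_minus[symmetric] minus_diff_eq e by simp
  with m(1) show "\<exists>m. on_side a m (b (- n)) \<and>
      sgn (b (- (n + 1)) - b (- n)) = mirror m (sgn (b (- n) - b (- (n - 1))))" by blast
qed

lemma interior_image:
  assumes f: "linear f" "inj f" and "f ` table a = table a"
  shows "f ` interior (table a) = interior (table a)"
  using interior_injective_linear_image[OF f] assms(3) by metis

lemma mids_rotate:
  assumes "c ^ 5 = 1" "m \<in> mids a"
  shows "c * m \<in> mids a"
proof -
  obtain d where d: "d ^ 5 = 1" "m = side_mid a 0 * d" using assms(2) by (auto simp: mids_eq)
  have "(c * d) ^ 5 = 1" using assms(1) d by (simp add: power_mult_distrib)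
  moreover have "c * m = side_mid a 0 * (c * d)" by (simp add: d mult_ac)
  ultimately show ?thesis unfolding mids_eq by blast
qed

lemma on_side_rotate:
  assumes "c ^ 5 = 1" "on_side a m z"
  shows "on_side a (c * m) (c * z)"
  using assms(2) mids_rotate[OF assms(1)] by (auto simp: on_side_def mult.assoc)

lemma linear_mult: "linear ((*) (c::complex))"
  by (simp add: bounded_linear.linear bounded_linear_mult_right)

lemma traj_rotate:
  assumes c: "c ^ 5 = 1" and b: "traj a b"
  shows "traj a (\<lambda>n. c * b n)"
  unfolding traj_def
proof (intro conjI allI)
  fix n
  have inj: "inj ((*) c)" using fifth_root_inverse(2)[OF c] by (simp add: inj_on_def)
  have "open_segment (c * b n) (c * b (n + 1)) = (*) c ` open_segment (b n) (b (n + 1))"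
    by (rule open_segment_linear_image[OF linear_mult inj])
  also have "\<dots> \<subseteq> (*) c ` interior (table a)" using b unfolding traj_def by (intro image_mono) blast
  also have "\<dots> = interior (table a)" by (rule interior_image[OF linear_mult inj rotation_table[OF c]])
  finally show "open_segment (c * b n) (c * b (n + 1)) \<subseteq> interior (table a)" .
  have "b n \<noteq> b (n + 1)" using b unfolding traj_def by blast
  then show "c * b n \<noteq> c * b (n + 1)" using inj by (auto dest: injD)
  obtain m where m: "on_side a m (b n)" "sgn (b (n + 1) - b n) = mirror m (sgn (b n - b (n - 1)))"
    using b unfolding traj_def by blast
  have "sgn (c * b (n + 1) - c * b n) = mirror (c * m) (sgn (c * b n - c * b (n - 1)))"
    unfolding sgn_rotate[OF c] m mirror_rotate[OF c] ..
  with on_side_rotate[OF c m(1)]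
  show "\<exists>m. on_side a m (c * b n) \<and> sgn (c * b (n + 1) - c * b n) = mirror m (sgn (c * b n - c * b (n - 1)))"
    by blast
qed

lemma traj_not_interior: "traj a b \<Longrightarrow> b n \<notin> interior (table a)"
  unfolding traj_def using on_side_not_interior by blast

section \<open>Initial data determining a trajectory\<close>

lemma traj_step_unique:
  assumes b: "traj a b" and b': "traj a b'"
    and "b n = b' n" "sgn (b (n + 1) - b n) = sgn (b' (n + 1) - b' n)"
  shows "b (n + 1) = b' (n + 1)"
proof (rule open_segment_endpoint_unique[of _ "b n" _ "interior (table a)"])
  show "b (n + 1) \<noteq> b n" using b unfolding traj_def by metis
  show "b' (n + 1) \<noteq> b n" using b' unfolding traj_def assms(3) by metis
  show "sgn (b (n + 1) - b n) = sgn (b' (n + 1) - b n)" using assms(3,4) by simp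
  show "open_segment (b n) (b (n + 1)) \<subseteq> interior (table a)" using b unfolding traj_def by blast
  show "open_segment (b n) (b' (n + 1)) \<subseteq> interior (table a)" using b' unfolding traj_def assms(3) by blast
qed (use traj_not_interior b b' in blast)+

lemma traj_forward_unique:
  assumes b: "traj a b" and b': "traj a b'"
    and "b 0 = b' 0" "sgn (b 1 - b 0) = sgn (b' 1 - b' 0)"
  shows "b (int n) = b' (int n) \<and> sgn (b (int n + 1) - b (int n)) = sgn (b' (int n + 1) - b' (int n))"
proof (induction n)
  case 0
  then show ?case using assms by simp
next
  case (Suc n)
  let ?k = "int n + 1"
  have S: "int (Suc n) = ?k" by simp
  have eq: "b ?k = b' ?k" using traj_step_unique[OF b b'] Suc by blast
  obtain m where m: "on_side a m (b ?k)" "sgn (b (?k + 1) - b ?k) = mirror m (sgn (b ?k - b (?k - 1)))"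
    using b unfolding traj_def by blast
  obtain m' where m': "on_side a m' (b' ?k)" "sgn (b' (?k + 1) - b' ?k) = mirror m' (sgn (b' ?k - b' (?k - 1)))"
    using b' unfolding traj_def by blast
  have "m = m'" using m(1) m'(1) eq on_side_unique by metis
  moreover have "sgn (b ?k - b (?k - 1)) = sgn (b' ?k - b' (?k - 1))" 
    unfolding add_diff_cancel_right' using Suc by (rule conjunct2)
  ultimately show ?case unfolding S m(2) m'(2) using eq by simp
qed

text \<open>Nonnegative times follow by induction. For negative times the reversed trajectories are
  compared; their initial directions agree after undoing the common mirror at bounce 0.\<close>

lemma traj_unique:
  assumes b: "traj a b" and b': "traj a b'"
    and 0: "b 0 = b' 0" "sgn (b 1 - b 0) = sgn (b' 1 - b' 0)"
  shows "b n = b' n"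
proof (cases "0 \<le> n")
  case True
  then show ?thesis using traj_forward_unique[OF assms, of "nat n"] by simp
next
  case False
  obtain m where m: "on_side a m (b 0)" "sgn (b (0 + 1) - b 0) = mirror m (sgn (b 0 - b (0 - 1)))"
    using b unfolding traj_def by blast
  obtain m' where m': "on_side a m' (b' 0)" "sgn (b' (0 + 1) - b' 0) = mirror m' (sgn (b' 0 - b' (0 - 1)))"
    using b' unfolding traj_def by blast
  have mm: "m = m'" using m(1) m'(1) 0 on_side_unique by metis
  have "m \<noteq> 0" using m mids_neq_0 by (auto simp: on_side_def)
  have "sgn (b 0 - b (- 1)) = mirror m (sgn (b 1 - b 0))" 
    using m(2) mirror_mirror[OF \<open>m \<noteq> 0\<close>] by simp
  also have "\<dots> = mirror m (sgn (b' 1 - b' 0))" using 0 by simp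
  also have "\<dots> = sgn (b' 0 - b' (- 1))" 
    using m'(2) mirror_mirror[OF \<open>m \<noteq> 0\<close>] mm by simp
  finally have "- sgn (b 0 - b (- 1)) = - sgn (b' 0 - b' (- 1))" by simp
  then have "sgn (b (- 1) - b 0) = sgn (b' (- 1) - b' 0)" 
    unfolding sgn_minus[symmetric] minus_diff_eq .
  then show ?thesis
    using traj_forward_unique[OF traj_reverse[OF b] traj_reverse[OF b'], of "nat (- n)"] 0 False by simp
qed

text \<open>The reflection \<open>f\<close> preserves the table and reverses the chord direction
  \<open>d\<close>. Both \<open>f x - x\<close> and \<open>d\<close> are negated by
  \<open>f\<close>, so they are parallel and \<open>f\<close> keeps the line of the chord:
  \<open>f x\<close> and \<open>f y\<close> have parameters \<open>s\<close> and
  \<open>s - 1\<close> on it. For \<open>s > 1\<close> the table would continue beyond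
  \<open>y\<close>, for \<open>s < 1\<close> before \<open>x\<close>, making an endpoint interior.
  Hence \<open>s = 1\<close> and \<open>f x = y\<close>.\<close>

lemma mirror_chord:
  assumes c: "c ^ 5 = 1" and xy: "x \<noteq> y" "open_segment x y \<subseteq> interior (table a)"
    and out: "x \<notin> interior (table a)" "y \<notin> interior (table a)"
    and tab: "x \<in> table a" "y \<in> table a"
    and dir: "(a / cnj a) * c * cnj (y - x) = - (y - x)"
  shows "y = (a / cnj a) * c * cnj x"
proof -
  define f where "f = (\<lambda>z. (a / cnj a) * c * cnj z)"
  define d where "d = y - x"
  have d: "d \<noteq> 0" "f d = - d" using xy dir by (simp_all add: d_def f_def)
  have f_tab: "f z \<in> table a" if "z \<in> table a" for z
    using reflection_table[OF c] that unfolding f_def by blast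
  have nz: "a \<noteq> 0" "cnj a \<noteq> 0" "c \<noteq> 0" "cnj c \<noteq> 0" using a_neq_0 fifth_root_inverse(2)[OF c] by simp_all
  have "f (f z) = (c * cnj c) * z" for z unfolding f_def using nz by (simp add: mult_ac)
  then have ff: "f (f z) = z" for z using fifth_root_inverse(1)[OF c] by simp
  have fd: "f (u - v) = f u - f v" for u v by (simp only: f_def complex_cnj_diff right_diff_distrib)
  define w where "w = f x - x"
  have fw: "f w = - w" unfolding w_def fd ff by simp
  define K where "K = (a / cnj a) * c"
  have "K \<noteq> 0" using nz by (simp add: K_def)
  have "K * cnj w = - w" "K * cnj d = - d" using fw d(2) by (simp_all only: f_def K_def)
  then have "K * cnj w * d = K * cnj d * w" by simp
  then have "cnj w * d = cnj d * w" using \<open>K \<noteq> 0\<close> by simp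
  then have "cnj (w / d) = w / d" using d(1) by (simp add: field_simps)
  then have "w / d \<in> \<real>" by (simp add: Reals_cnj_iff)
  then obtain s where "w / d = of_real s" by (elim Reals_cases)
  then have "w = s *\<^sub>R d" using d(1) by (simp add: scaleR_conv_of_real field_simps)
  then have fx: "f x = x + s *\<^sub>R d" by (simp add: w_def algebra_simps)
  have "f y = f x + f d" unfolding d_def fd by simp
  then have fy: "f y = x + (s - 1) *\<^sub>R d" unfolding fx d(2) by (simp add: algebra_simps)
  have y: "y = x + 1 *\<^sub>R d" and x: "x = x + 0 *\<^sub>R d" by (simp_all add: d_def)
  have mid: "x + (1/2) *\<^sub>R d \<in> interior (table a)"
    using between_in_open_segment[OF d(1), of 0 "1/2" 1 x] xy(2) unfolding d_def by auto
  \<comment> \<open>By convexity, everything strictly between an interior point and a point of the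
    table is interior.\<close>
  have conv: "open_segment (x + (1/2) *\<^sub>R d) z \<subseteq> interior (table a)" if "z \<in> table a" for z
    using in_interior_closure_convex_segment[OF _ mid] that closure_subset[of "table a"]
    by (auto simp: table_def convex_convex_hull)
  have "\<not> s > 1"
  proof
    assume "s > 1"
    then have "x + 1 *\<^sub>R d \<in> open_segment (x + (1/2) *\<^sub>R d) (x + s *\<^sub>R d)"
      by (intro between_in_open_segment d) auto
    then show False using conv[OF f_tab[OF tab(1)]] out(2) unfolding fx y[symmetric] by blast
  qed
  moreover have "\<not> s < 1"
  proof
    assume "s < 1"
    then have "x + 0 *\<^sub>R d \<in> open_segment (x + (1/2) *\<^sub>R d) (x + (s - 1) *\<^sub>R d)"
      by (intro between_in_open_segment d) auto
    then show False using conv[OF f_tab[OF tab(2)]] out(1) unfolding fy x[symmetric] by blast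
  qed
  ultimately have "s = 1" by simp
  then show ?thesis using fx y unfolding f_def by simp
qed

end

section \<open>Unfolding to the necklace\<close>

definition rotn :: "(complex \<Rightarrow> complex) \<Rightarrow> bool" where
  "rotn g \<longleftrightarrow> (\<exists>c. c ^ 5 = 1 \<and> g = (\<lambda>z. c * z))"

text \<open>The minus sign turns the axis reflections of the pentagon into the reflections in lines
  parallel to its sides, which send the table to its negative.\<close>

definition refln :: "complex \<Rightarrow> (complex \<Rightarrow> complex) \<Rightarrow> bool" where
  "refln a g \<longleftrightarrow> (\<exists>c. c ^ 5 = 1 \<and> g = (\<lambda>z. - (a / cnj a) * c * cnj z))"

context pentagon
begin

lemma norm_axis: "(a / cnj a) * cnj (a / cnj a) = 1"
  using a_neq_0 by simp

text \<open>The argument of a midpoint differs from that of \<open>a\<close> by an odd multiple of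
  pi / 5. The quotient by the conjugate doubles arguments, so the difference becomes a multiple of 2
  pi / 5.\<close>

lemma mids_axis:
  assumes "m \<in> mids a"
  obtains c where "c ^ 5 = 1" "m / cnj m = (a / cnj a) * c"
proof -
  obtain d where d: "d ^ 5 = 1" "m = side_mid a 0 * d" using assms by (auto simp: mids_eq)
  have "1 + \<omega> \<noteq> 0" using mid0_neq_0 unfolding side_mid_0 by auto
  then have "1 + cnj \<omega> \<noteq> 0" by (metis complex_cnj_add complex_cnj_one complex_cnj_zero_iff)
  have "\<omega> * (1 + cnj \<omega>) = 1 + \<omega>"
    using fifth_root_inverse(1)[OF omega_pow5] by (simp add: algebra_simps)
  then have "(1 + \<omega>) / (1 + cnj \<omega>) = \<omega>" using \<open>1 + cnj \<omega> \<noteq> 0\<close> by (metis nonzero_eq_divide_eq)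
  moreover have "d / cnj d = d * d"
    using fifth_root_inverse[OF d(1)] fifth_root_inverse[OF fifth_root_inverse(3)[OF d(1)]] 
    by (simp add: field_simps)
  moreover have "m / cnj m = (a / cnj a) * ((1 + \<omega>) / (1 + cnj \<omega>)) * (d / cnj d)"
    unfolding d side_mid_0 by simp
  ultimately have "m / cnj m = (a / cnj a) * (\<omega> * (d * d))" by simp
  moreover have "(\<omega> * (d * d)) ^ 5 = 1" using d(1) omega_pow5 by (simp add: power_mult_distrib)
  ultimately show ?thesis using that by blast
qed

lemma refln_mirror: "m \<in> mids a \<Longrightarrow> refln a (mirror m)"
  using mids_axis[of m] unfolding refln_def mirror_def
  by (metis (no_types, lifting) mult_minus_left)

lemma rotn_comp_refln:
  assumes "rotn g" "refln a h"
  shows "refln a (g \<circ> h)"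
proof -
  obtain c d where c: "c ^ 5 = 1" "g = (\<lambda>z. c * z)" and d: "d ^ 5 = 1" "h = (\<lambda>z. - (a / cnj a) * d * cnj z)"
    using assms unfolding rotn_def refln_def by blast
  have "(c * d) ^ 5 = 1" using c d by (simp add: power_mult_distrib)
  moreover have "g \<circ> h = (\<lambda>z. - (a / cnj a) * (c * d) * cnj z)"
    unfolding c(2) d(2) by (simp add: fun_eq_iff mult_ac)
  ultimately show ?thesis unfolding refln_def by blast
qed

lemma refln_comp_refln:
  assumes "refln a g" "refln a h"
  shows "rotn (g \<circ> h)"
proof -
  obtain c d where c: "c ^ 5 = 1" "g = (\<lambda>z. - (a / cnj a) * c * cnj z)"
    and d: "d ^ 5 = 1" "h = (\<lambda>z. - (a / cnj a) * d * cnj z)"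
    using assms unfolding refln_def by blast
  have "(c * cnj d) ^ 5 = 1"
    unfolding power_mult_distrib c(1) fifth_root_inverse(3)[OF d(1)] by simp
  moreover have "g (h z) = ((a / cnj a) * cnj (a / cnj a)) * (c * cnj d * z)" for z
    unfolding c(2) d(2) by (simp only: complex_cnj_mult complex_cnj_minus complex_cnj_cnj minus_mult_minus mult_minus_left mult_minus_right minus_minus mult_ac)
  then have "g \<circ> h = (\<lambda>z. c * cnj d * z)"
    unfolding norm_axis by (simp add: fun_eq_iff)
  ultimately show ?thesis unfolding rotn_def by blast
qed

lemma rotn_table: "rotn g \<Longrightarrow> g ` table a = table a"
  using rotation_table unfolding rotn_def by blast

lemma refln_table:
  assumes "refln a g"
  shows "g ` table a = uminus ` table a"
proof -
  obtain c where c: "c ^ 5 = 1" "g = (\<lambda>z. - (a / cnj a) * c * cnj z)"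
    using assms unfolding refln_def by blast
  have "g ` table a = uminus ` (\<lambda>z. (a / cnj a) * c * cnj z) ` table a"
    unfolding c(2) image_image by simp
  then show ?thesis unfolding reflection_table[OF c(1)] .
qed

lemma not_rotn_refln: "rotn g \<Longrightarrow> refln a g \<Longrightarrow> False"
  using rotn_table refln_table minus_table_neq by metis

lemma refln_side_refl: "refln a (side_refl a k)"
proof -
  have "side_refl a k = mirror (side_mid a k)" by (rule ext) (rule side_refl_eq)
  then show ?thesis using refln_mirror[OF side_mid_mem] by simp
qed

lemma dihedral_cases: "g \<in> dihedral a \<Longrightarrow> rotn g \<or> refln a g"
proof (induction rule: dihedral.induct)
  case id_mem
  have "rotn id" unfolding rotn_def by (intro exI[of _ 1]) (simp add: fun_eq_iff)
  then show ?case ..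
next
  case (comp_mem g k)
  then show ?case using rotn_comp_refln refln_comp_refln refln_side_refl by blast
qed

lemma isometry:
  assumes "rotn g \<or> refln a g"
  shows "linear g" "norm (g z) = norm z" "inj g"
proof -
  show n: "norm (g z) = norm z" for z
    using assms a_neq_0 fifth_root_norm by (auto simp: rotn_def refln_def norm_mult norm_divide)
  show l: "linear g"
    using assms by (auto simp: rotn_def refln_def linear_mult 
        intro!: linearI simp: algebra_simps add_divide_distrib scaleR_conv_of_real)
  show "inj g" using n l by (metis linear_injective_0 norm_eq_zero)
qed

lemma isometry_sgn:
  assumes "rotn g \<or> refln a g"
  shows "g (sgn z) = sgn (g z)"
  using isometry[OF assms] by (simp add: sgn_div_norm linear_cmul)

lemma isometry_bij:
  assumes "rotn g \<or> refln a g"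
  shows "bij g"
  using isometry(1,3)[OF assms] linear_injective_imp_surjective by (metis bijI)

text \<open>The factor \<open>s\<close> is the quotient of \<open>h\<close> by \<open>g\<close>, a
  rotation. Keeping \<open>g\<close> applied on the left lets its injectivity finish later
  comparisons.\<close>

lemma same_type:
  assumes "rotn g \<and> rotn h \<or> refln a g \<and> refln a h"
  obtains s where "s ^ 5 = 1" "\<And>w. g (s * w) = h w"
  using assms
proof
  assume "rotn g \<and> rotn h"
  then obtain c d where c: "c ^ 5 = 1" "g = (\<lambda>z. c * z)" and d: "d ^ 5 = 1" "h = (\<lambda>z. d * z)"
    unfolding rotn_def by blast
  have "(cnj c * d) ^ 5 = 1"
    unfolding power_mult_distrib d(1) fifth_root_inverse(3)[OF c(1)] by simp
  moreover have "g (cnj c * d * w) = (c * cnj c) * h w" for w unfolding c(2) d(2) by (simp only: mult_ac)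
  then have "g (cnj c * d * w) = h w" for w using fifth_root_inverse(1)[OF c(1)] by simp
  ultimately show ?thesis using that by blast
next
  assume "refln a g \<and> refln a h"
  then obtain c d where c: "c ^ 5 = 1" "g = (\<lambda>z. - (a / cnj a) * c * cnj z)"
    and d: "d ^ 5 = 1" "h = (\<lambda>z. - (a / cnj a) * d * cnj z)"
    unfolding refln_def by blast
  have "(c * cnj d) ^ 5 = 1"
    unfolding power_mult_distrib c(1) fifth_root_inverse(3)[OF d(1)] by simp
  moreover have "g (c * cnj d * w) = (c * cnj c) * h w" for w 
    unfolding c(2) d(2) complex_cnj_mult complex_cnj_cnj by (simp only: mult_ac)
  then have "g (c * cnj d * w) = h w" for w using fifth_root_inverse(1)[OF c(1)] by simp
  ultimately show ?thesis using that by blast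
qed

text \<open>Here the quotient of \<open>h\<close> by \<open>g\<close> reverses orientation, so it is
  a map as in \<open>refln\<close>.\<close>

lemma opposite_type:
  assumes "rotn g \<and> refln a h \<or> refln a g \<and> rotn h"
  obtains c where "c ^ 5 = 1" "\<And>w. g (- (a / cnj a) * c * cnj w) = h w"
  using assms
proof
  assume "rotn g \<and> refln a h"
  then obtain c d where c: "c ^ 5 = 1" "g = (\<lambda>z. c * z)"
    and d: "d ^ 5 = 1" "h = (\<lambda>z. - (a / cnj a) * d * cnj z)"
    unfolding rotn_def refln_def by blast
  have "(cnj c * d) ^ 5 = 1"
    unfolding power_mult_distrib d(1) fifth_root_inverse(3)[OF c(1)] by simp
  moreover have "g (- (a / cnj a) * (cnj c * d) * cnj w) = (c * cnj c) * h w" for w 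
    unfolding c(2) d(2) by (simp only: mult_ac)
  then have "g (- (a / cnj a) * (cnj c * d) * cnj w) = h w" for w using fifth_root_inverse(1)[OF c(1)] by simp
  ultimately show ?thesis using that by blast
next
  assume "refln a g \<and> rotn h"
  then obtain c d where c: "c ^ 5 = 1" "g = (\<lambda>z. - (a / cnj a) * c * cnj z)" and d: "d ^ 5 = 1" "h = (\<lambda>z. d * z)"
    unfolding rotn_def refln_def by blast
  have "(c * cnj d) ^ 5 = 1"
    unfolding power_mult_distrib c(1) fifth_root_inverse(3)[OF d(1)] by simp
  moreover have "g (- (a / cnj a) * (c * cnj d) * cnj w) = ((a / cnj a) * cnj (a / cnj a)) * ((c * cnj c) * h w)" for w 
    unfolding c(2) d(2) 
    by (simp only: complex_cnj_mult complex_cnj_minus complex_cnj_cnj minus_mult_minus mult_minus_left mult_minus_right minus_minus mult_ac)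
  then have "g (- (a / cnj a) * (c * cnj d) * cnj w) = h w" for w 
    unfolding norm_axis fifth_root_inverse(1)[OF c(1)] by simp
  ultimately show ?thesis using that by blast
qed

section \<open>Gluing of neighbouring sheets\<close>

lemma rotn_mids: "rotn g \<Longrightarrow> m \<in> mids a \<Longrightarrow> g m \<in> mids a"
  using mids_rotate unfolding rotn_def by blast

text \<open>By \<open>mids_axis\<close> the vector \<open>(a / cnj a) * cnj m\<close> is a fifth
  root of unity times \<open>m\<close>, so \<open>- g\<close> merely rotates \<open>m\<close> to
  another midpoint.\<close>

lemma refln_mids:
  assumes "refln a g" "m \<in> mids a"
  shows "- g m \<in> mids a"
proof -
  obtain c where c: "c ^ 5 = 1" "g = (\<lambda>z. - (a / cnj a) * c * cnj z)"
    using assms unfolding refln_def by blast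
  obtain d where d: "d ^ 5 = 1" "m / cnj m = (a / cnj a) * d" using assms(2) by (rule mids_axis)
  have "cnj m \<noteq> 0" using mids_neq_0[OF assms(2)] by simp
  then have "m = (a / cnj a) * d * cnj m" using d(2) by (metis nonzero_eq_divide_eq)
  then have "cnj d * m = (d * cnj d) * ((a / cnj a) * cnj m)" by (metis mult.assoc mult.commute)
  then have "cnj d * m = (a / cnj a) * cnj m" unfolding fifth_root_inverse(1)[OF d(1)] by simp
  then have "- g m = (c * cnj d) * m" unfolding c(2) by (simp add: mult_ac)
  moreover have "(c * cnj d) ^ 5 = 1"
    unfolding power_mult_distrib c(1) fifth_root_inverse(3)[OF d(1)] by simp
  ultimately show ?thesis using mids_rotate[OF _ assms(2)] by simp
qed

text \<open>All midpoints have the same fifth power, and negation changes its sign because 5 is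
  odd.\<close>

lemma minus_mids:
  assumes "m \<in> mids a" 
  shows "- m \<notin> mids a"
proof
  assume "- m \<in> mids a"
  then obtain c where c: "c ^ 5 = 1" "- m = side_mid a 0 * c" by (auto simp: mids_eq)
  obtain d where d: "d ^ 5 = 1" "m = side_mid a 0 * d" using assms by (auto simp: mids_eq)
  have "c = - d" using c(2) mid0_neq_0 unfolding d by (metis mult_left_cancel mult_minus_right)
  then have "c ^ 5 = - (d ^ 5)" by simp
  then show False using c d by simp
qed

text \<open>The sides are parallel and equally long, so their midpoints agree up to sign; they are not
  equal because \<open>g\<close> and \<open>h\<close> have opposite orientation.\<close>

lemma glued_sides_opposite:
  assumes gh: "rotn g \<and> refln a h \<or> refln a g \<and> rotn h"
    and m: "m \<in> mids a" "m' \<in> mids a"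
    and ends: "{h (m' * (1 - \<i> * half_side)), h (m' * (1 + \<i> * half_side))}
      = (+) t ` {g (m * (1 - \<i> * half_side)), g (m * (1 + \<i> * half_side))}"
  shows "t = - 2 * g m"
proof -
  define \<delta> where "\<delta> z = g (z * (\<i> * half_side))" for z
  define \<epsilon> where "\<epsilon> z = h (z * (\<i> * half_side))" for z
  have lg: "linear g" and lh: "linear h" using gh isometry by blast+
  have ge: "g (m * (1 - \<i> * half_side)) = g m - \<delta> m" "g (m * (1 + \<i> * half_side)) = g m + \<delta> m"
    by (simp_all add: \<delta>_def right_diff_distrib distrib_left linear_diff[OF lg] linear_add[OF lg])
  have he: "h (m' * (1 - \<i> * half_side)) = h m' - \<epsilon> m'" "h (m' * (1 + \<i> * half_side)) = h m' + \<epsilon> m'"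
    by (simp_all add: \<epsilon>_def right_diff_distrib distrib_left linear_diff[OF lh] linear_add[OF lh])
  have "h m' = t + g m \<and> (\<epsilon> m' = \<delta> m \<or> \<epsilon> m' = - \<delta> m)"
  proof -
    from ends consider "h m' - \<epsilon> m' = t + (g m - \<delta> m)" "h m' + \<epsilon> m' = t + (g m + \<delta> m)"
      | "h m' - \<epsilon> m' = t + (g m + \<delta> m)" "h m' + \<epsilon> m' = t + (g m - \<delta> m)"
      unfolding ge he by (auto simp: doubleton_eq_iff)
    moreover have half: "u = v" if "2 * u = 2 * v" for u v :: complex using that by simp
    ultimately show ?thesis
    proof cases
      case 1
      have "2 * h m' = 2 * (t + g m)" "2 * \<epsilon> m' = 2 * \<delta> m" using 1 by algebra+
      then show ?thesis using half by blast
    next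
      case 2
      have "2 * h m' = 2 * (t + g m)" "2 * \<epsilon> m' = 2 * (- \<delta> m)" using 2 by algebra+
      then show ?thesis using half by blast
    qed
  qed
  then have 1: "h m' = t + g m" and 2: "\<epsilon> m' = \<delta> m \<or> \<epsilon> m' = - \<delta> m" by auto
  \<comment> \<open>Rotations commute with \<open>\<i>\<close> and reflections anticommute with it,
    so a half-side vector determines the image of the midpoint up to sign.\<close>
  have "\<delta> m = \<i> * half_side * g m \<or> \<delta> m = - (\<i> * half_side * g m)"
    using gh by (auto simp: \<delta>_def rotn_def refln_def)
  moreover have "\<epsilon> m' = \<i> * half_side * h m' \<or> \<epsilon> m' = - (\<i> * half_side * h m')"
    using gh by (auto simp: \<epsilon>_def rotn_def refln_def)
  ultimately have "\<i> * half_side * h m' = \<i> * half_side * g m \<or> \<i> * half_side * h m' = \<i> * half_side * - g m"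
    using 2 by auto
  then have 3: "h m' = g m \<or> h m' = - g m"
    using half_side_neq_0 by (simp only: mult_cancel_left) simp
  moreover have "h m' \<noteq> g m"
    using gh
  proof
    assume "rotn g \<and> refln a h"
    then have "g m \<in> mids a" "- h m' \<in> mids a" using rotn_mids refln_mids m by blast+
    then show ?thesis using minus_mids by auto
  next
    assume "refln a g \<and> rotn h"
    then have "- g m \<in> mids a" "h m' \<in> mids a" using rotn_mids refln_mids m by blast+
    then show ?thesis using minus_mids by auto
  qed
  ultimately have "h m' = - g m" by blast
  then show ?thesis using 1 by algebra
qed

text \<open>The exit point from \<open>g\<close> and the entry point into \<open>h\<close> fold to
  the same boundary point \<open>w\<close> of the table. Thus straight motion in sheet
  \<open>g\<close> folds to one chord of the billiard.\<close>

lemma necklace_step: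
  assumes "crosses (necklace a) \<theta> (g, x) (h, z)"
  obtains m r where "m \<in> mids a" "r > 0" "g \<in> dihedral a" "h = g \<circ> mirror m"
    "g (inv h z - inv g x) = of_real r * \<theta>"
proof -
  obtain E F r t where gd: "g \<in> dihedral a" and hd: "h \<in> dihedral a"
    and E: "E \<in> (`) g ` table_sides a" and F: "F \<in> (`) h ` table_sides a" "F = (+) t ` E"
    and glue: "\<exists>k. E = g ` side a k \<and> h = g \<circ> side_refl a k"
    and r: "r > 0" "x + of_real r * \<theta> \<in> rel_interior E" and z: "z = x + of_real r * \<theta> + t"
    using assms unfolding crosses_def necklace_def prod.case surface.select_convs by blast
  obtain k where k: "E = g ` side a k" "h = g \<circ> side_refl a k" using glue by blast
  obtain j where j: "F = h ` side a j" using F(1) by (auto simp: table_sides_def)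
  define m where "m = side_mid a k"
  have m: "m \<in> mids a" unfolding m_def by (rule side_mid_mem)
  have sr: "side_refl a k = mirror m" unfolding m_def by (rule ext) (rule side_refl_eq)
  have g: "rotn g \<or> refln a g" using dihedral_cases gd by blast
  have h: "rotn h \<or> refln a h" using dihedral_cases hd by blast
  have gh: "rotn g \<and> refln a h \<or> refln a g \<and> rotn h"
    using g rotn_comp_refln refln_comp_refln refln_side_refl k(2) by blast
  have Eseg: "E = closed_segment (g (m * (1 - \<i> * half_side))) (g (m * (1 + \<i> * half_side)))"
    unfolding k(1) side_segment m_def[symmetric]
    by (rule closed_segment_linear_image[symmetric, OF isometry(1)[OF g]])
  define m' where "m' = side_mid a j"
  have m': "m' \<in> mids a" unfolding m'_def by (rule side_mid_mem)
  have Fseg: "F = closed_segment (h (m' * (1 - \<i> * half_side))) (h (m' * (1 + \<i> * half_side)))"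
    unfolding j side_segment m'_def[symmetric]
    by (rule closed_segment_linear_image[symmetric, OF isometry(1)[OF h]])
  have "t = - 2 * g m"
  proof (rule glued_sides_opposite[OF gh m m'])
    have "closed_segment (h (m' * (1 - \<i> * half_side))) (h (m' * (1 + \<i> * half_side))) =
      closed_segment (t + g (m * (1 - \<i> * half_side))) (t + g (m * (1 + \<i> * half_side)))"
      unfolding Fseg[symmetric] closed_segment_translation Eseg[symmetric] by (rule F(2))
    then show "{h (m' * (1 - \<i> * half_side)), h (m' * (1 + \<i> * half_side))}
      = (+) t ` {g (m * (1 - \<i> * half_side)), g (m * (1 + \<i> * half_side))}"
      unfolding closed_segment_eq image_insert image_empty .
  qed
  have "rel_interior E = g ` rel_interior (side a k)"
    unfolding k(1) using isometry[OF g]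
    by (intro rel_interior_injective_linear_image) (auto simp: linear_linear)
  then obtain w where w: "x + of_real r * \<theta> = g w" "w \<in> rel_interior (side a k)" using r(2) by auto
  obtain s where s: "w = m * (1 + \<i> * of_real s)"
    using on_side_rel_interior[OF w(2)] unfolding on_side_def m_def by blast
  \<comment> \<open>On the line of the side, \<open>mirror m\<close> acts as the translation by
    \<open>- 2 * m\<close>; its image under \<open>g\<close> is exactly the gluing translation
    \<open>t\<close>.\<close>
  have "mirror m w = w - 2 * m"
    using mids_neq_0[OF m] unfolding s mirror_def by (simp add: algebra_simps)
  then have "h w = g w - g (2 * m)"
    unfolding k(2) sr by (simp add: linear_diff[OF isometry(1)[OF g]])
  also have "g (2 * m) = 2 * g m" using g by (auto simp: rotn_def refln_def)
  finally have "h w = z" unfolding z w(1) \<open>t = - 2 * g m\<close> by simp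
  then have hz: "inv h z = w" by (rule inv_f_eq[OF isometry(3)[OF h]])
  have "g (inv g x) = x" using isometry_bij[OF g] by (simp add: bij_is_surj surj_f_inv_f)
  then have "g (inv h z - inv g x) = of_real r * \<theta>"
    unfolding hz linear_diff[OF isometry(1)[OF g]] w(1)[symmetric] by simp
  then show ?thesis using that m r(1) gd k(2) unfolding sr by blast
qed

end

section \<open>Periods and symmetry\<close>

lemma is_period_multiple:
  assumes "is_period f n"
  shows "f (k + int n * j) = f k"
proof -
  have step: "f (i + int n) = f i" for i using assms by (simp add: is_period_def)
  show ?thesis
  proof (induction j rule: int_induct[where k = 0])
    case base
    show ?case by simp
  next
    case (step1 i)
    have "f (k + int n * (i + 1)) = f (k + int n * i + int n)" by (simp add: algebra_simps)
    then show ?case using step1 step by simp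
  next
    case (step2 i)
    have "f (k + int n * (i - 1)) = f (k + int n * (i - 1) + int n)" using step by simp
    also have "\<dots> = f (k + int n * i)" by (simp add: algebra_simps)
    finally show ?case using step2 by simp
  qed
qed

lemma is_period_primitive:
  assumes "periodic f"
  shows "is_period f (primitive_period f)"
  using assms unfolding periodic_def primitive_period_def by (metis LeastI)

lemma primitive_period_dvd:
  assumes "is_period f n"
  shows "primitive_period f dvd n"
proof (rule ccontr)
  let ?p = "primitive_period f"
  assume "\<not> ?p dvd n"
  then have pos: "n mod ?p > 0" by (simp add: dvd_eq_mod_eq_0)
  have p: "is_period f ?p" using assms is_period_primitive periodic_def by blast
  then have "?p > 0" by (simp add: is_period_def)
  have "f (k + int (n mod ?p)) = f k" for k
  proof -
    have "n = n mod ?p + ?p * (n div ?p)" by simp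
    then have "int n = int (n mod ?p) + int ?p * int (n div ?p)" by (metis of_nat_add of_nat_mult)
    then have "f (k + int (n mod ?p)) = f (k + int n)"
      using is_period_multiple[OF p, of "k + int (n mod ?p)" "int (n div ?p)"] by (simp add: add.assoc)
    then show ?thesis using assms by (simp add: is_period_def)
  qed
  then have "is_period f (n mod ?p)" using pos by (simp add: is_period_def)
  then have "?p \<le> n mod ?p" unfolding primitive_period_def by (rule Least_le)
  then show False using mod_less_divisor[OF \<open>?p > 0\<close>, of n] by linarith
qed

lemma power_shift:
  assumes "\<And>n. b (n + k) = c * (b n :: complex)"
  shows "b (n + int j * k) = c ^ j * b n"
proof (induction j)
  case (Suc j)
  have "b (n + int (Suc j) * k) = b (n + int j * k + k)" by (simp add: algebra_simps)
  then show ?case using assms Suc by (simp add: mult.assoc)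
qed simp

context pentagon
begin

lemma billiard_traj:
  assumes "billiard_trajectory a b" "\<And>n. b n \<noteq> b (n + 1)"
  shows "traj a b"
  unfolding traj_def
proof (intro conjI allI)
  fix n
  show "open_segment (b n) (b (n + 1)) \<subseteq> interior (table a)"
    using assms(1) unfolding billiard_trajectory_def by blast
  show "b n \<noteq> b (n + 1)" by (rule assms(2))
  obtain k where "b n \<in> rel_interior (side a k)"
    "sgn (b (n + 1) - b n) = side_refl a k (sgn (b n - b (n - 1)))"
    using assms(1) unfolding billiard_trajectory_def by blast
  then show "\<exists>m. on_side a m (b n) \<and> sgn (b (n + 1) - b n) = mirror m (sgn (b n - b (n - 1)))"
    unfolding side_refl_eq using on_side_rel_interior by blast
qed

section \<open>Rotational symmetry as a shift of the bounce index\<close>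

lemma traj_nonzero:
  assumes "traj a b"
  shows "b n \<noteq> 0"
proof
  assume 0: "b n = 0"
  obtain m where "on_side a m (b n)" using assms unfolding traj_def by blast
  then obtain t where m: "m \<in> mids a" and t: "0 = m * (1 + \<i> * of_real t)"
    unfolding on_side_def 0 by blast
  have "1 + \<i> * complex_of_real t \<noteq> 0" by (simp add: complex_eq_iff)
  then show False using t mids_neq_0[OF m] by simp
qed

text \<open>Bounce points are limits of open chords, and the convex hull of finitely many points is
  closed.\<close>

lemma traj_in_table:
  assumes "traj a b"
  shows "b n \<in> table a"
proof -
  have "finite (range (vertex a))"
    unfolding range_vertex by (intro finite_imageI finite_roots_unity) simp
  then have "closed (table a)"
    unfolding table_def by (intro compact_imp_closed finite_imp_compact_convex_hull)
  have "open_segment (b n) (b (n + 1)) \<subseteq> table a" "b n \<noteq> b (n + 1)"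
    using assms interior_subset unfolding traj_def by blast+
  then have "closure (open_segment (b n) (b (n + 1))) \<subseteq> table a"
    using \<open>closed (table a)\<close> by (intro closure_minimal)
  then show ?thesis using \<open>b n \<noteq> b (n + 1)\<close> by auto
qed

text \<open>The rotated first chord is covered by finitely many chords of the trajectory, so one of
  them shares infinitely many points with it. By \<open>chord_unique\<close> the two agree up to
  direction, and uniqueness of trajectories extends this to all times.\<close>

lemma rotation_symmetric_shift:
  assumes b: "traj a b" and per: "is_period b N" and sym: "rotation5_symmetric (trajectory_set b)"
  obtains k where "\<And>n. b (n + k) = \<omega> * b n"
proof -
  define T where "T = trajectory_set b"
  have "N > 0" using per by (simp add: is_period_def)
  \<comment> \<open>Periodicity makes the union finite, as the pigeonhole argument requires.\<close>
  have T: "T = (\<Union>j\<in>{0..<int N}. closed_segment (b j) (b (j + 1)))"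
  proof -
    have "closed_segment (b n) (b (n + 1)) =
      closed_segment (b (n mod int N)) (b (n mod int N + 1))" for n
    proof -
      have e: "n = n mod int N + int N * (n div int N)" by simp
      have "b n = b (n mod int N)" using is_period_multiple[OF per, of "n mod int N" "n div int N"] by simp
      moreover have "b (n + 1) = b (n mod int N + 1)"
        using is_period_multiple[OF per, of "n mod int N + 1" "n div int N"] by (simp add: add.commute add.left_commute)
      ultimately show ?thesis by simp
    qed
    moreover have "n mod int N \<in> {0..<int N}" for n using \<open>N > 0\<close> by simp
    ultimately show ?thesis unfolding T_def trajectory_set_def by blast
  qed
  have rot: "(*) \<omega> ` T = T" using sym unfolding rotation5_symmetric_def T_def omega_def .
  have b': "traj a (\<lambda>n. \<omega> * b n)" by (rule traj_rotate[OF omega_pow5 b])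
  define A where "A = \<omega> * b 0"
  define B where "B = \<omega> * b 1"
  have AB: "A \<noteq> B" "open_segment A B \<subseteq> interior (table a)"
    using b' unfolding traj_def A_def B_def by (metis add.left_neutral)+
  have "closed_segment (b 0) (b 1) \<subseteq> T" 
    using UN_upper[of 0 UNIV "\<lambda>n. closed_segment (b n) (b (n + 1))"]
    by (simp add: T_def trajectory_set_def)
  then have "closed_segment A B \<subseteq> T"
    unfolding A_def B_def closed_segment_linear_image[OF linear_mult] using rot by blast
  then have "open_segment A B \<subseteq> (\<Union>j\<in>{0..<int N}. open_segment A B \<inter> closed_segment (b j) (b (j + 1)))"
    using segment_open_subset_closed[of A B] unfolding T by blast
  moreover have "infinite (open_segment A B)" using AB(1) by simp
  ultimately have "infinite (\<Union>j\<in>{0..<int N}. open_segment A B \<inter> closed_segment (b j) (b (j + 1)))"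
    using infinite_super by blast
  then obtain j where j: "infinite (open_segment A B \<inter> closed_segment (b j) (b (j + 1)))"
    using finite_UN_I[OF finite_atLeastLessThan_int] by blast
  define S where "S = open_segment A B \<inter> closed_segment (b j) (b (j + 1))"
  have "S \<noteq> {}" using j unfolding S_def[symmetric] by (rule infinite_imp_nonempty)
  then obtain p where p: "p \<in> S" by blast
  have "infinite (S - {p})" using j unfolding S_def by simp
  then have "S - {p} \<noteq> {}" by (rule infinite_imp_nonempty)
  then obtain q where q: "q \<in> S" "p \<noteq> q" by blast
  have oj: "open_segment (b j) (b (j + 1)) \<subseteq> interior (table a)" using b unfolding traj_def by blast
  have out: "A \<notin> interior (table a)" "B \<notin> interior (table a)"
    unfolding A_def B_def using traj_not_interior[OF b'] by blast+
  have "b j = A \<and> b (j + 1) = B \<or> b j = B \<and> b (j + 1) = A"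
    by (rule chord_unique[OF AB oj out traj_not_interior[OF b] traj_not_interior[OF b] q(2)]) (use p q S_def in blast)+
  then show ?thesis
  proof
    assume h: "b j = A \<and> b (j + 1) = B"
    have "b (n + j) = \<omega> * b n" for n
      using traj_unique[OF traj_shift[OF b] b', of j n] h unfolding A_def B_def by (simp add: add.commute)
    then show ?thesis using that by blast
  next
    \<comment> \<open>A reversed match would let the involution sending n to j + 1 - n act as
      rotation by \<open>\<omega>\<close>. Applying it twice gives
      \<open>\<omega>\<^sup>2 = 1\<close>, against \<open>Re_omega_2\<close>.\<close>
    assume h: "b j = B \<and> b (j + 1) = A"
    have r: "traj a (\<lambda>n. b (- n + (j + 1)))" using traj_reverse[OF traj_shift[OF b]] .
    have e: "b (- n + (j + 1)) = \<omega> * b n" for n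
      by (rule traj_unique[OF r b']) (use h in \<open>simp_all add: A_def B_def add.commute\<close>)
    have "b 0 = b (- (- 0 + (j + 1)) + (j + 1))" by simp
    also have "\<dots> = \<omega> * b (- 0 + (j + 1))" by (rule e)
    also have "\<dots> = \<omega> * (\<omega> * b 0)" by (simp only: e)
    finally have "\<omega>\<^sup>2 = 1" using traj_nonzero[OF b, of 0] by (simp add: power2_eq_square)
    then have "Re (\<omega>\<^sup>2) = 1" by simp
    then show ?thesis using Re_omega_2 by simp
  qed
qed

lemma rotation_symmetric_even_shift:
  assumes b: "traj a b" and per: "is_period b N" and sym: "rotation5_symmetric (trajectory_set b)"
  obtains k :: nat where "k > 0" "even k" "\<And>n. b (n + int k) = \<omega> * b n"
proof -
  obtain k where k: "\<And>n. b (n + k) = \<omega> * b n" using rotation_symmetric_shift[OF assms] by blast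
  have N: "N > 0" using per by (simp add: is_period_def)
  obtain Y :: int where Y: "k + int N * Y > 0"
  proof
    have "1 * (\<bar>k\<bar> + 1) \<le> int N * (\<bar>k\<bar> + 1)" using N by (intro mult_right_mono) auto
    moreover have "0 < k + 1 * (\<bar>k\<bar> + 1)" by (cases "0 \<le> k") simp_all
    ultimately show "k + int N * (\<bar>k\<bar> + 1) > 0" by (meson add_left_mono less_le_trans)
  qed
  \<comment> \<open>Adding periods makes the shift positive. The factor 6 makes it even and keeps
    the rotation, because \<open>\<omega> ^ 6 = \<omega>\<close>.\<close>
  define l where "l = 6 * (k + int N * Y)"
  have "l > 0" using Y unfolding l_def by simp
  have "b (n + l) = \<omega> * b n" for n
  proof -
    have "n + l = (n + int 6 * k) + int N * (6 * Y)" unfolding l_def by simp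
    then have "b (n + l) = b ((n + int 6 * k) + int N * (6 * Y))" by (rule arg_cong)
    also have "\<dots> = b (n + int 6 * k)" by (rule is_period_multiple[OF per])
    also have "\<dots> = \<omega> ^ 6 * b n" by (rule power_shift[where b = b and k = k, OF k])
    also have "\<omega> ^ 6 = \<omega>" using omega_pow5 by (simp add: eval_nat_numeral)
    finally show ?thesis .
  qed
  moreover have "even l" unfolding l_def by simp
  then have "even (nat l)" using \<open>l > 0\<close> by (simp add: even_nat_iff)
  ultimately show ?thesis using that[of "nat l"] \<open>l > 0\<close> by simp
qed

text \<open>Midpoints have equal modulus, so the ratios \<open>w\<close> and \<open>w'\<close> of
  consecutive bounces are unit numbers. The reflection law at a midpoint makes \<open>w' - 1\<close>
  a positive multiple of \<open>w - 1\<close>, and \<open>unit_ray\<close> gives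
  \<open>w' = w\<close>.\<close>

lemma mids_constant_ratio:
  assumes b: "traj a b" and mids: "\<And>n. b n \<in> mids a"
  obtains w where "w ^ 5 = 1" "w \<noteq> 1" "\<And>n. b (n + 1) = w * b n"
proof -
  have ratio: "b (n + 1) / b n = b n / b (n - 1)" for n
  proof -
    define m where "m = b n"
    define w where "w = b n / b (n - 1)"
    define w' where "w' = b (n + 1) / b n"
    have nz: "m \<noteq> 0" "b (n - 1) \<noteq> 0" using traj_nonzero[OF b] by (auto simp: m_def)
    have nw: "norm w = 1" "norm w' = 1"
      unfolding w_def w'_def norm_divide norm_mids[OF mids] using mid0_neq_0 by simp_all
    have "b (n - 1) \<noteq> b (n - 1 + 1)" using b unfolding traj_def by blast
    then have "w \<noteq> 1" using nz by (auto simp: w_def)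
    have cw: "w * cnj w = 1" using nw by (simp flip: complex_norm_square)
    have "b (n - 1) = cnj w * w * b (n - 1)" using cw by (simp add: mult.commute)
    then have prev: "b (n - 1) = cnj w * m" using nz by (simp add: w_def m_def)
    have next': "b (n + 1) = w' * m" using nz by (simp add: w'_def m_def)
    have "m \<in> mids a" unfolding m_def by (rule mids)
    have "on_side a m (b n)"
      unfolding on_side_def using \<open>m \<in> mids a\<close> half_side_neq_0
      by (intro conjI exI[of _ 0]) (simp_all add: m_def)
    moreover obtain m' where m': "on_side a m' (b n)"
      "sgn (b (n + 1) - b n) = mirror m' (sgn (b n - b (n - 1)))"
      using b unfolding traj_def by blast
    ultimately have "m' = m" using on_side_unique by blast
    define r where "r = norm (w' * m - m)"
    define r' where "r' = norm (m - cnj w * m)"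
    have "b n \<noteq> b (n + 1)" using b unfolding traj_def by blast
    then have "r > 0" unfolding r_def next'[symmetric] unfolding m_def by simp
    moreover have "r' > 0"
      using \<open>b (n - 1) \<noteq> b (n - 1 + 1)\<close> unfolding r'_def prev[symmetric] unfolding m_def by simp
    ultimately have pos: "r > 0" "r' > 0" .
    \<comment> \<open>In multiples of \<open>m\<close>, \<open>mirror m\<close> conjugates and
      negates the coefficient, so \<open>1 - cnj w\<close> becomes \<open>w - 1\<close>.\<close>
    have "(w' * m - m) / of_real r = mirror m ((m - cnj w * m) / of_real r')"
      using m'(2) unfolding \<open>m' = m\<close> sgn_eq prev next' m_def[symmetric] r_def[symmetric] r'_def[symmetric] .
    also have "m - cnj w * m = m * (1 - cnj w)" by (simp add: algebra_simps)
    also have "mirror m (m * (1 - cnj w) / of_real r') = - (m * (1 - w)) / of_real r'"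
      using nz(1) by (simp add: mirror_def)
    also have "- (m * (1 - w)) = (w - 1) * m" by (simp add: algebra_simps)
    finally have "(w' * m - m) * of_real r' = (w - 1) * m * of_real r"
      using frac_eq_eq[of "of_real r :: complex" "of_real r'"] pos by simp
    then have "m * ((w' - 1) * of_real r') = m * ((w - 1) * of_real r)" by algebra
    then have "(w' - 1) * of_real r' = (w - 1) * of_real r" using nz(1) by (simp only: mult_cancel_left) simp
    then have "w' - 1 = (w - 1) * of_real r / of_real r'"
      using pos by (metis less_irrefl nonzero_eq_divide_eq of_real_eq_0_iff)
    then have "w' - 1 = of_real (r / r') * (w - 1)" by simp
    then show ?thesis unfolding w_def[symmetric] w'_def[symmetric]
      using unit_ray[of "r / r'" w w'] pos nw \<open>w \<noteq> 1\<close> by simp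
  qed
  define w where "w = b 1 / b 0"
  have "b (n + 1) / b n = w" for n
  proof (induction n rule: int_induct[where k = 0])
    case base
    show ?case by (simp add: w_def)
  next
    case (step1 i)
    then show ?case using ratio[of "i + 1"] by simp
  next
    case (step2 i)
    then show ?case using ratio[of i] by simp
  qed
  then have step: "b (n + 1) = w * b n" for n
    using traj_nonzero[OF b, of n] by (metis nonzero_eq_divide_eq)
  have "w ^ 5 = 1"
  proof -
    obtain c d where c: "c ^ 5 = 1" "b 0 = side_mid a 0 * c" and d: "d ^ 5 = 1" "b 1 = side_mid a 0 * d"
      using mids[of 0] mids[of 1] unfolding mids_eq by blast
    then show ?thesis unfolding w_def using mid0_neq_0 by (simp add: power_divide)
  qed
  moreover have "w \<noteq> 1"
  proof
    assume "w = 1"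
    then have "b (0 + 1) = b 0" using step[of 0] by simp
    then show False using b unfolding traj_def by metis
  qed
  ultimately show ?thesis using that step by blast
qed

text \<open>Ratios \<open>\<omega>\<close> and \<open>\<omega> ^ 4\<close> step to an adjacent side,
  \<open>\<omega>\<^sup>2\<close> and \<open>\<omega> ^ 3\<close> to a non-adjacent one. Exponents 3
  and 4 are -2 and -1 modulo 5, so there the unordered pair is read from its later bounce.\<close>

lemma ratio_mini_or_star:
  assumes bt: "billiard_trajectory a b" and mids: "\<And>n. b n \<in> mids a"
    and w: "w ^ 5 = 1" "w \<noteq> 1" "\<And>n. b (n + 1) = w * b n"
  shows "mini_pentagon a b \<or> star a b"
proof -
  obtain j where j: "j < 5" "w = \<omega> ^ j" using w(1) by (rule fifth_root_cases)
  have shift: "side_mid a (k + i) = \<omega> ^ i * side_mid a k" for k i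
    unfolding side_mid_eq[of a "k + i"] side_mid_eq[of a k] by (simp add: power_add)
  have mid: "\<exists>k. b n = side_mid a k" for n using mids[of n] unfolding mids_def by blast
  have fwd: "\<exists>k. {b n, b (n + 1)} = {side_mid a k, side_mid a (k + i)}" if "w = \<omega> ^ i" for n i
  proof -
    obtain k where k: "b n = side_mid a k" using mid by blast
    have "b (n + 1) = side_mid a (k + i)" unfolding w(3) shift k that ..
    then show ?thesis unfolding k by (intro exI[of _ k]) (rule arg_cong)
  qed
  have bwd: "\<exists>k. {b n, b (n + 1)} = {side_mid a k, side_mid a (k + i)}" if "\<omega> ^ i * w = 1" for n i
  proof -
    obtain k where k: "b (n + 1) = side_mid a k" using mid by blast
    have "side_mid a (k + i) = \<omega> ^ i * b (n + 1)" unfolding shift k ..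
    also have "\<dots> = (\<omega> ^ i * w) * b n" unfolding w(3) by (simp only: mult.assoc)
    finally have "b n = side_mid a (k + i)" unfolding that by simp
    then have "{b n, b (n + 1)} = {side_mid a (k + i), side_mid a k}" unfolding k by (rule arg_cong)
    also have "\<dots> = {side_mid a k, side_mid a (k + i)}" by (rule insert_commute)
    finally show ?thesis by (rule exI)
  qed
  have "j \<noteq> 0" using w(2) j(2) by (metis power_0)
  then consider "j = 1" | "j = 2" | "j = 3" | "j = 4" using j(1) by linarith
  then show ?thesis
  proof cases
    case 1
    then have "mini_pentagon a b" unfolding mini_pentagon_def using bt fwd[of 1] j(2) by blast
    then show ?thesis ..
  next
    case 2
    then have "star a b" unfolding star_def using bt fwd[of 2] j(2) by blast
    then show ?thesis ..
  next
    case 3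
    then have "\<omega>\<^sup>2 * w = 1" using omega_pow5 j(2) by (simp flip: power_add)
    then have "star a b" unfolding star_def using bt bwd[of 2] by blast
    then show ?thesis ..
  next
    case 4
    then have "\<omega> ^ 1 * w = 1" using omega_pow5 j(2) by (simp only: power_add[symmetric]) simp
    then have "mini_pentagon a b" unfolding mini_pentagon_def using bt bwd[of 1] by blast
    then show ?thesis ..
  qed
qed

lemma mini_or_star_period:
  assumes b: "traj a b" and "mini_pentagon a b \<or> star a b"
  shows "is_period b 5"
proof -
  have "b n \<in> mids a" for n
    using assms(2) side_mid_mem unfolding mini_pentagon_def star_def by (metis insert_iff singletonD)
  then obtain w where w: "w ^ 5 = 1" "\<And>n. b (n + 1) = w * b n" using mids_constant_ratio[OF b] by metis
  have "b (n + int 5 * 1) = w ^ 5 * b n" for n by (rule power_shift[where b = b and k = 1, OF w(2)])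
  then show ?thesis using w(1) by (simp add: is_period_def)
qed

end

text \<open>What remains of the lift once the surfaces are forgotten: the sheets \<open>g n\<close>,
  the fixed direction \<open>D\<close>, and the projection \<open>p\<close> to the double pentagon
  expressed through the bounces.\<close>

locale lifted_trajectory = pentagon +
  fixes b :: "int \<Rightarrow> complex" and g :: "int \<Rightarrow> complex \<Rightarrow> complex"
    and D :: complex and p :: "int \<Rightarrow> complex set \<times> complex"
  assumes b: "traj a b"
    and g: "rotn (g n) \<or> refln a (g n)"
    and alternate: "rotn (g (n + 1)) \<longleftrightarrow> \<not> rotn (g n)"
    and dir: "g n (sgn (b (n + 1) - b n)) = D"
    and p: "p n = (g n ` table a, g n (b n))"
begin

lemma not_rotn: "\<not> rotn (g n) \<longleftrightarrow> refln a (g n)"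
  using g not_rotn_refln by blast

lemma rotn_shift: "rotn (g (n + int m)) \<longleftrightarrow> (even m \<longleftrightarrow> rotn (g n))"
proof (induction m)
  case (Suc m)
  have "n + int (Suc m) = (n + int m) + 1" by simp
  then have "rotn (g (n + int (Suc m))) \<longleftrightarrow> \<not> rotn (g (n + int m))" using alternate by presburger
  then show ?case using Suc.IH even_Suc[of m] by blast
qed simp

lemma even_shift:
  assumes "even m"
  obtains s where "s ^ 5 = 1" "\<And>w. g (n + int m) (s * w) = g n w"
proof (rule same_type[of "g (n + int m)" "g n"])
  show "rotn (g (n + int m)) \<and> rotn (g n) \<or> refln a (g (n + int m)) \<and> refln a (g n)"
    using rotn_shift[of n m] not_rotn assms by blast
qed (rule that)

text \<open>The sheet of the double pentagon remembers only the orientation of the sheet above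
  it.\<close>

lemma image_table_eq_iff: "g m ` table a = g n ` table a \<longleftrightarrow> (rotn (g m) \<longleftrightarrow> rotn (g n))"
  using rotn_table refln_table not_rotn minus_table_neq by metis

lemma velocity_neq_0: "sgn (b (n + 1) - b n) \<noteq> 0"
proof -
  have "b n \<noteq> b (n + 1)" using b unfolding traj_def by blast
  then show ?thesis by (simp add: sgn_zero_iff)
qed

text \<open>Equal polygons at times 0 and \<open>M\<close> force even \<open>M\<close>. The two
  sheets then differ by a rotation \<open>s\<close>, which relates the bounce points, and also the
  velocities since \<open>D\<close> is fixed; uniqueness does the rest.\<close>

lemma period_lift:
  assumes "is_period p M"
  shows "even M" "\<exists>s. s ^ 5 = 1 \<and> (\<forall>n. b (n + int M) = s * b n)"
proof -
  have "p (0 + int M) = p 0" using assms unfolding is_period_def by blast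
  then have eq: "g (0 + int M) ` table a = g 0 ` table a" "g (0 + int M) (b (0 + int M)) = g 0 (b 0)"
    unfolding p by simp_all
  then show "even M" unfolding image_table_eq_iff using rotn_shift[of 0 M] by blast
  then obtain s where s: "s ^ 5 = 1" "\<And>w. g (0 + int M) (s * w) = g 0 w" using even_shift by blast
  have inj: "inj (g (0 + int M))" using g isometry(3) by blast
  have "g (0 + int M) (b (0 + int M)) = g (0 + int M) (s * b 0)" unfolding eq(2) s(2) ..
  then have 0: "b (0 + int M) = s * b 0" using inj by (rule injD[rotated])
  have "g (0 + int M) (sgn (b (0 + int M + 1) - b (0 + int M))) = g (0 + int M) (s * sgn (b (0 + 1) - b 0))"
    unfolding dir s(2) ..
  then have 1: "sgn (b (0 + int M + 1) - b (0 + int M)) = s * sgn (b (0 + 1) - b 0)" 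
    using inj by (rule injD[rotated])
  have "b (n + int M) = s * b n" for n
  proof (rule traj_unique[OF traj_shift[OF b] traj_rotate[OF s(1) b]])
    show "b (0 + int M) = s * b 0" by (rule 0)
    have "sgn (b (1 + int M) - b (0 + int M)) = s * sgn (b 1 - b 0)" using 1 by (simp add: add.commute)
    then show "sgn (b (1 + int M) - b (0 + int M)) = sgn (s * b 1 - s * b 0)"
      unfolding sgn_rotate[OF s(1)] .
  qed
  then show "\<exists>s. s ^ 5 = 1 \<and> (\<forall>n. b (n + int M) = s * b n)" using s(1) by blast
qed

text \<open>The two sheets differ by some rotation \<open>s\<close>. Both \<open>s\<close> and
  \<open>c\<close> applied to the velocity give vectors that \<open>g (n + int m)\<close> sends to
  \<open>D\<close>, so \<open>s = c\<close>, and the entry points agree as well.\<close>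

lemma even_shift_period:
  assumes m: "m > 0" "even m" and c: "c ^ 5 = 1" and shift: "\<And>n. b (n + int m) = c * b n"
  shows "is_period p m"
  unfolding is_period_def
proof (intro conjI allI m)
  fix n
  obtain s where s: "s ^ 5 = 1" "\<And>w. g (n + int m) (s * w) = g n w" using even_shift[OF m(2)] by blast
  let ?v = "sgn (b (n + 1) - b n)"
  have "n + int m + 1 = (n + 1) + int m" by simp
  then have v: "sgn (b (n + int m + 1) - b (n + int m)) = c * ?v"
    by (simp only: shift sgn_rotate[OF c])
  have "g (n + int m) (s * ?v) = D" unfolding s(2) by (rule dir)
  moreover have "g (n + int m) (c * ?v) = D" unfolding v[symmetric] by (rule dir)
  ultimately have "g (n + int m) (s * ?v) = g (n + int m) (c * ?v)" by simp
  moreover have "inj (g (n + int m))" using g isometry(3) by blast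
  ultimately have "s * ?v = c * ?v" by (rule injD[rotated])
  then have "s = c" using velocity_neq_0[of n] by simp
  then have "g (n + int m) (b (n + int m)) = g n (b n)" unfolding shift using s(2) by simp
  moreover have "g (n + int m) ` table a = g n ` table a"
    unfolding image_table_eq_iff using rotn_shift[of n m] m(2) by blast
  ultimately show "p (n + int m) = p n" unfolding p by simp
qed

text \<open>An odd shift compares sheets of opposite orientation. The velocity, unchanged by the
  period, is thus fixed by a map in \<open>refln\<close>, that is, reversed by a reflection
  preserving the table; \<open>mirror_chord\<close> applies.\<close>

lemma odd_period_reflect:
  assumes N: "is_period b N" "odd N"
  obtains c where "c ^ 5 = 1" "b (n + 1) = (a / cnj a) * c * cnj (b n)"
proof -
  have "rotn (g (n + int N)) \<and> refln a (g n) \<or> refln a (g (n + int N)) \<and> rotn (g n)"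
    using rotn_shift[of n N] not_rotn N(2) by blast
  then obtain c where c: "c ^ 5 = 1" "\<And>w. g (n + int N) (- (a / cnj a) * c * cnj w) = g n w"
    by (rule opposite_type) blast
  define d where "d = b (n + 1) - b n"
  have per: "b (i + int N) = b i" for i using N(1) unfolding is_period_def by blast
  have "n + int N + 1 = (n + 1) + int N" by simp
  then have v: "sgn (b (n + int N + 1) - b (n + int N)) = sgn d" by (simp only: per d_def)
  have "g (n + int N) (- (a / cnj a) * c * cnj (sgn d)) = D" unfolding c(2) d_def by (rule dir)
  moreover have "g (n + int N) (sgn d) = D" unfolding v[symmetric] by (rule dir)
  ultimately have "g (n + int N) (sgn d) = g (n + int N) (- (a / cnj a) * c * cnj (sgn d))" by simp
  moreover have "inj (g (n + int N))" using g isometry(3) by blast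
  ultimately have 1: "sgn d = - (a / cnj a) * c * cnj (sgn d)" by (rule injD[rotated])
  have "b n \<noteq> b (n + 1)" using b unfolding traj_def by blast
  then have d: "d = of_real (norm d) * sgn d" unfolding d_def sgn_eq by simp
  have "(a / cnj a) * c * cnj d = of_real (norm d) * ((a / cnj a) * c * cnj (sgn d))"
    by (subst d) (simp add: mult_ac)
  also have "\<dots> = of_real (norm d) * - sgn d" by (subst (2) 1) simp
  also have "\<dots> = - d" by (subst (3) d) simp
  finally have "(a / cnj a) * c * cnj d = - d" .
  moreover have "open_segment (b n) (b (n + 1)) \<subseteq> interior (table a)" using b unfolding traj_def by blast
  ultimately have "b (n + 1) = (a / cnj a) * c * cnj (b n)"
    using traj_not_interior[OF b] traj_in_table[OF b] \<open>b n \<noteq> b (n + 1)\<close>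
    unfolding d_def by (intro mirror_chord[OF c(1)])
  then show ?thesis using that c(1) by blast
qed

text \<open>Reflecting negates the signed distance from the bounce point to the midpoint of its side,
  so an odd period forces that distance to vanish.\<close>

lemma odd_period_mids:
  assumes N: "is_period b N" "odd N"
  shows "b n \<in> mids a"
proof -
  have "\<exists>m t. m \<in> mids a \<and> t\<^sup>2 < half_side\<^sup>2 \<and> b n = m * (1 + \<i> * of_real t)" for n
    using b unfolding traj_def on_side_def by blast
  then obtain m t where mt: "\<And>n. m n \<in> mids a" "\<And>n. (t n)\<^sup>2 < half_side\<^sup>2"
    "\<And>n. b n = m n * (1 + \<i> * of_real (t n))" by metis
  have step: "t (n + 1) = - t n" for n
  proof -
    obtain c where c: "c ^ 5 = 1" "b (n + 1) = (a / cnj a) * c * cnj (b n)"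
      using odd_period_reflect[OF N] by blast
    \<comment> \<open>\<open>h\<close> is the negative of the reflection of the chord, so
      \<open>refln_mids\<close> makes \<open>- h (m n)\<close> the midpoint of the next side;
      conjugation turns the parameter \<open>t n\<close> into \<open>- t n\<close>.\<close>
    define h where "h = (\<lambda>z. - (a / cnj a) * c * cnj z)"
    have "refln a h" unfolding refln_def h_def using c(1) by blast
    then have mem: "- h (m n) \<in> mids a" using refln_mids mt(1) by blast
    have "b (n + 1) = - h (m n) * (1 + \<i> * of_real (- t n))"
      unfolding c(2) mt(3)[of n] h_def by simp
    then show ?thesis
      using side_param_unique[OF mt(1) mem mt(2)] unfolding mt(3)[of "n + 1"] by blast
  qed
  have pow: "t (n + int j) = (- 1) ^ j * t n" for n j
  proof (induction j)
    case (Suc j)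
    have "n + int (Suc j) = (n + int j) + 1" by simp
    then show ?case using step[of "n + int j"] Suc by (simp only: power_Suc)
  qed simp
  have "t (n + int N) = - t n" using pow[of n N] N(2) by simp
  moreover have "t (n + int N) = t n"
  proof -
    have "m (n + int N) * (1 + \<i> * of_real (t (n + int N))) = m n * (1 + \<i> * of_real (t n))"
      using N(1) unfolding mt(3)[symmetric] is_period_def by blast
    then show ?thesis using side_param_unique[OF mt(1) mt(1) mt(2)] by blast
  qed
  ultimately have "t n = 0" by simp
  then show ?thesis using mt(1)[of n] mt(3)[of n] by simp
qed

lemma primitive_periods:
  assumes per: "periodic b" "periodic p" and sym: "rotation5_symmetric (trajectory_set b)"
  shows "even (primitive_period b) \<Longrightarrow> primitive_period b = 5 * primitive_period p"
    and "odd (primitive_period b) \<Longrightarrow> 2 * primitive_period b = 5 * primitive_period p"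
proof -
  define N where "N = primitive_period b"
  define M where "M = primitive_period p"
  have N: "is_period b N" and M: "is_period p M"
    unfolding N_def M_def using per is_period_primitive by blast+
  have pos: "N > 0" "M > 0" using N M unfolding is_period_def by blast+
  have "even M" using period_lift(1)[OF M] .
  obtain s where s: "s ^ 5 = 1" "\<And>n. b (n + int M) = s * b n" using period_lift(2)[OF M] by blast
  have "b (n + int 5 * int M) = b n" for n
    using power_shift[where b = b and k = "int M", OF s(2), of n 5] s(1) by simp
  then have "is_period b (5 * M)" using pos unfolding is_period_def by simp
  then have N5: "N dvd 5 * M" unfolding N_def by (rule primitive_period_dvd)
  \<comment> \<open>Otherwise \<open>M\<close>, and with it \<open>N\<close>, would divide the even
    shift that rotates by \<open>\<omega>\<close>, which would then fix the trajectory.\<close>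
  have N_M: "\<not> N dvd M"
  proof
    assume "N dvd M"
    obtain k where k: "k > 0" "even k" "\<And>n. b (n + int k) = \<omega> * b n"
      using rotation_symmetric_even_shift[OF b N sym] by blast
    have "is_period p k" by (rule even_shift_period[OF k(1,2) omega_pow5 k(3)])
    then have "M dvd k" unfolding M_def by (rule primitive_period_dvd)
    then have "N dvd k" using \<open>N dvd M\<close> by (rule dvd_trans[rotated])
    then obtain i where "k = N * i" by blast
    then have "b (0 + int k) = b 0" using is_period_multiple[OF N, of 0 "int i"] by simp
    then show False using k(3)[of 0] omega_neq_1 traj_nonzero[OF b, of 0] by simp
  qed
  \<comment> \<open>A multiple of \<open>N\<close> is a shift with trivial rotation
    \<open>c = 1\<close>; being even, it is a period of \<open>p\<close>.\<close>
  have M_dvd: "M dvd k" if "k > 0" "even k" "N dvd k" for k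
  proof -
    obtain i where "k = N * i" using \<open>N dvd k\<close> by blast
    then have "b (n + int k) = 1 * b n" for n using is_period_multiple[OF N, of n "int i"] by simp
    then have "is_period p k" using even_shift_period[OF that(1,2), of 1] by simp
    then show ?thesis unfolding M_def by (rule primitive_period_dvd)
  qed
  have prime5: "prime (5::nat)" by simp
  have dvd5: "i = 1 \<or> i = 5" if "i dvd 5" for i :: nat using prime5 that prime_nat_iff by blast
  show "primitive_period b = 5 * primitive_period p" if "even (primitive_period b)"
  proof -
    \<comment> \<open>\<open>M\<close> divides \<open>N\<close> and \<open>N\<close> divides
      \<open>5 * M\<close>, so the quotient is 1 or 5, and \<open>N_M\<close> excludes 1.\<close>
    have "M dvd N" using M_dvd[of N] pos that unfolding N_def by simp
    then obtain i where i: "N = M * i" by blast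
    then have "i dvd 5" using N5 pos by (simp add: mult.commute)
    moreover have "i \<noteq> 1" using N_M i by auto
    ultimately show ?thesis using dvd5 i unfolding N_def M_def by (metis mult.commute)
  qed
  show "2 * primitive_period b = 5 * primitive_period p" if "odd (primitive_period b)"
  proof -
    \<comment> \<open>Cancelling the factor 2 of \<open>M = 2 * M'\<close> gives
      \<open>M' dvd N\<close> and \<open>N dvd 5 * M'\<close>; the quotient 1 would make
      \<open>N\<close> divide \<open>M\<close>.\<close>
    have "coprime N 2" using that unfolding N_def by simp
    obtain M' where M': "M = 2 * M'" using \<open>even M\<close> by blast
    have "M dvd 2 * N" using M_dvd[of "2 * N"] pos by simp
    then obtain i where i: "N = M' * i" unfolding M' by auto
    have "N dvd 2 * (5 * M')" using N5 unfolding M' by (simp add: mult.left_commute)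
    then have "N dvd 5 * M'" using \<open>coprime N 2\<close> coprime_dvd_mult_right_iff by blast
    then have "i dvd 5" using pos unfolding i M' by (simp add: mult.commute)
    moreover have "i \<noteq> 1" using N_M i M' by auto
    ultimately have "i = 5" using dvd5 by blast
    then show ?thesis using i M' unfolding N_def M_def by simp
  qed
qed

text \<open>The two special trajectories have a period dividing 5. Conversely an odd period puts all
  bounces at midpoints, and the constant ratio between them identifies the trajectory.\<close>

lemma mini_or_star_iff_odd:
  assumes bt: "billiard_trajectory a b" and per: "periodic b"
  shows "mini_pentagon a b \<or> star a b \<longleftrightarrow> odd (primitive_period b)"
proof
  assume "mini_pentagon a b \<or> star a b"
  then have "primitive_period b dvd 5" using mini_or_star_period[OF b] primitive_period_dvd by blast
  then show "odd (primitive_period b)" by (meson dvd_trans odd_numeral)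
next
  assume odd: "odd (primitive_period b)"
  have mids: "b n \<in> mids a" for n using odd_period_mids[OF is_period_primitive[OF per] odd] .
  show "mini_pentagon a b \<or> star a b"
    using mids_constant_ratio[OF b mids] ratio_mini_or_star[OF bt mids] by metis
qed

end

lemma (in pentagon) corresponds_lift:
  assumes bt: "billiard_trajectory a b" and "corresponds a p b"
  obtains g D where "lifted_trajectory a b g D p"
proof -
  obtain L where L: "surface_trajectory (necklace a) L" "\<And>n. p n = covering a (L n)" "\<And>n. b n = folding (L n)"
    using assms(2) unfolding corresponds_def by blast
  obtain \<theta> where \<theta>: "\<theta> \<noteq> 0" "\<And>n. crosses (necklace a) \<theta> (L n) (L (n + 1))"
    using L(1) unfolding surface_trajectory_def by blast
  define g where "g n = fst (L n)" for n
  have Ln: "L n = (g n, snd (L n))" for n by (simp add: g_def)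
  have bn: "b n = inv (g n) (snd (L n))" for n unfolding L(3) folding_def g_def by (simp add: case_prod_beta)
  have step: "\<exists>m r. m \<in> mids a \<and> r > 0 \<and> g n \<in> dihedral a \<and> g (n + 1) = g n \<circ> mirror m \<and>
      g n (b (n + 1) - b n) = of_real r * \<theta>" for n
  proof -
    have "crosses (necklace a) \<theta> (g n, snd (L n)) (g (n + 1), snd (L (n + 1)))"
      using \<theta>(2)[of n] by (simp add: g_def)
    then show ?thesis unfolding bn by (rule necklace_step) blast
  qed
  have type: "rotn (g n) \<or> refln a (g n)" for n using step dihedral_cases by blast
  have alt: "rotn (g (n + 1)) \<longleftrightarrow> \<not> rotn (g n)" for n
  proof -
    obtain m where m: "m \<in> mids a" "g (n + 1) = g n \<circ> mirror m" using step by blast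
    show ?thesis
      using type[of n] rotn_comp_refln refln_comp_refln refln_mirror[OF m(1)] not_rotn_refln 
      unfolding m(2) by blast
  qed
  \<comment> \<open>The chord length \<open>r\<close> varies with \<open>n\<close>, so only the
    normalised direction is constant.\<close>
  have dir: "g n (sgn (b (n + 1) - b n)) = sgn \<theta>" for n
  proof -
    obtain r where r: "r > 0" "g n (b (n + 1) - b n) = of_real r * \<theta>" using step by blast
    show ?thesis unfolding isometry_sgn[OF type] r(2) using r(1) by (simp add: sgn_mult sgn_of_real)
  qed
  have "b n \<noteq> b (n + 1)" for n
  proof
    assume "b n = b (n + 1)"
    obtain r where r: "r > 0" "g n (b (n + 1) - b n) = of_real r * \<theta>" using step by blast
    have "g n 0 = 0" using linear_0[OF isometry(1)[OF type]] .
    then show False using r \<theta>(1) \<open>b n = b (n + 1)\<close> by simp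
  qed
  then have b: "traj a b" using billiard_traj bt by blast
  have "p n = (g n ` table a, g n (b n))" for n
  proof -
    have "g n (b n) = snd (L n)"
      unfolding bn using isometry_bij[OF type] by (simp add: bij_is_surj surj_f_inv_f)
    then show ?thesis unfolding L(2) covering_def g_def by (simp add: case_prod_beta)
  qed
  then have "lifted_trajectory a b g (sgn \<theta>) p"
    using b type alt dir by unfold_locales
  then show ?thesis using that by blast
qed

theorem proposition3p38:
  fixes a :: complex
    and \<tau> :: "int \<Rightarrow> complex"
    and p :: "int \<Rightarrow> complex set \<times> complex"
  assumes "a \<noteq> 0" and "has_horizontal_side a"
    and "billiard_trajectory a \<tau>" and "periodic \<tau>"
    and "rotation5_symmetric (trajectory_set \<tau>)"
    and "corresponds a p \<tau>"
  shows "(\<not> (mini_pentagon a \<tau> \<or> star a \<tau>) \<longrightarrow>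
            length (billiard_sequence a \<tau>) = 5 * length (cutting_word (double_pentagon a) p)) \<and>
         (mini_pentagon a \<tau> \<or> star a \<tau> \<longrightarrow>
            real (length (billiard_sequence a \<tau>)) =
              (5 * real (length (cutting_word (double_pentagon a) p))) / 2)"
proof -
  interpret pentagon a by unfold_locales (rule assms(1))
  obtain g D where "lifted_trajectory a \<tau> g D p" using corresponds_lift assms(3,6) by blast
  then interpret lifted_trajectory a \<tau> g D p .
  have per: "periodic p" using assms(6) unfolding corresponds_def by blast
  \<comment> \<open>Both words have one letter per index below a primitive period, so the claim
    compares primitive periods, split by parity.\<close>
  note lengths = primitive_periods[OF assms(4) per assms(5)]
  note odd = mini_or_star_iff_odd[OF assms(3,4)]
  show ?thesis
  proof (intro conjI impI)
    assume "\<not> (mini_pentagon a \<tau> \<or> star a \<tau>)"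
    then show "length (billiard_sequence a \<tau>) = 5 * length (cutting_word (double_pentagon a) p)"
      using lengths(1) unfolding odd by (simp add: billiard_sequence_def cutting_word_def)
  next
    assume "mini_pentagon a \<tau> \<or> star a \<tau>"
    then have "2 * primitive_period \<tau> = 5 * primitive_period p" using lengths(2) unfolding odd by simp
    then have "2 * real (primitive_period \<tau>) = 5 * real (primitive_period p)" by linarith
    then show "real (length (billiard_sequence a \<tau>)) =
        (5 * real (length (cutting_word (double_pentagon a) p))) / 2"
      by (simp add: billiard_sequence_def cutting_word_def)
  qed
qed

end
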